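(* Let $|\psi(\theta)\rangle_{AB}=\cos\theta|00\rangle+\sin\theta|11\rangle$ with $\theta\in(0,\pi/2)$ and let $|\Omega\rangle_{A'B'K}$ be an arbitrary pure state. Define $$\mu_*(\theta,\Omega)=\inf_{\{M_m\}}\sup_m\lambda_{\max}(\Psi_m),$$ where the infimum is over POVMs $\{M_m\}_m$ on $K$, that is, families of measurement operators on $K$ satisfying $\sum_m M_m^\dagger M_m=\mathbb{I}_K$, the supremum is over the outcomes $m$, and $\lambda_{\max}(\Psi_m)$ is the largest squared Schmidt coefficient across $AA'\mid BB'$ of the normalized post-measurement state $|\Psi_m\rangle$ conditioned on outcome $m$. Then deterministic Bell-pair restoration on $AB$ in the Bank-measures model is possible if and only if $\mu_*(\theta,\Omega)\le 1/2$.
   Context: $A,B$ are qubits. There are three parties: Alice holds $A,A'$; Bob holds $B,B'$; the Bank holds $K$. The global initial state is $|\psi(\theta)\rangle_{AB}\otimes|\Omega\rangle_{A'B'K}$. LOCC means local quantum operations by Alice and Bob together with classical communication between them. For a chosen POVM $\{M_m\}_m$ on $K$ with $\sum_m M_m^\dagger M_m=\mathbb{I}_K$, the unnormalized post-measurement pure state on Alice's and Bob's registers is $$|\widetilde\Psi_m\rangle_{AA'BB'}=(\mathbb{I}_{AA'BB'}\otimes M_m)\bigl(|\psi(\theta)\rangle_{AB}\otimes|\Omega\rangle_{A'B'K}\bigr),$$ outcome $m$ has probability $p_m=\langle\widetilde\Psi_m|\widetilde\Psi_m\rangle$, and conditioning on $m$ (with $p_m>0$) gives the normalized state $|\Psi_m\rangle=|\widetilde\Psi_m\rangle/\sqrt{p_m}$.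 Bank-measures model: the Bank performs a measurement $\{M_m\}_m$ of its choice on $K$ and broadcasts the classical outcome $m$; after receiving $m$, Alice (on $AA'$) and Bob (on $BB'$) may apply an LOCC map, which may depend on $m$. The Bank participates in no other way. Deterministic Bell-pair restoration on $AB$ means deterministic production of a perfect Bell pair, such as $|\Phi^+\rangle=\frac{1}{\sqrt2}(|00\rangle+|11\rangle)$, on the original registers $A,B$, in every measurement branch $m$, for some choice of the Bank's measurement; arbitrary leftover registers are allowed. *)

theory Defs
  imports "HOL-Analysis.Analysis"
begin

text \<open>
  A vector of type \<open>complex ^ 'n\<close> is a ket of a system with computational basis \<open>'n\<close>; a composite
  system has the product type as its basis. The norm on \<open>complex ^ 'n\<close> is the Hilbert space norm,
  but its library inner product is only the real part of the Hermitian one, hence \<open>cinner\<close>.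
\<close>

definition cinner :: "complex ^ 'n \<Rightarrow> complex ^ 'n \<Rightarrow> complex" where
  "cinner u v = (\<Sum>i\<in>UNIV. cnj (u $ i) * v $ i)"

definition adj :: "complex ^ 'n ^ 'm \<Rightarrow> complex ^ 'm ^ 'n" where
  "adj A = (\<chi> i j. cnj (A $ j $ i))"

definition ket_tensor ::
    "complex ^ 'm \<Rightarrow> complex ^ 'n \<Rightarrow> complex ^ ('m::finite \<times> 'n::finite)" (infixl "\<otimes>" 70) where
  "u \<otimes> v = (\<chi> p. u $ fst p * v $ snd p)"

definition op_tensor ::
    "complex ^ 'm ^ 'm \<Rightarrow> complex ^ 'n ^ 'n
      \<Rightarrow> complex ^ ('m::finite \<times> 'n::finite) ^ ('m \<times> 'n)" (infixl "\<otimes>\<^sub>m" 70) where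
  "A \<otimes>\<^sub>m B = (\<chi> p q. A $ fst p $ fst q * B $ snd p $ snd q)"

definition proj :: "complex ^ 'n \<Rightarrow> complex ^ 'n ^ 'n" where
  "proj v = (\<chi> i j. v $ i * cnj (v $ j))"

definition ket :: "'n \<Rightarrow> complex ^ 'n::finite" where
  "ket i = axis i 1"

subsection \<open>Schmidt coefficients\<close>

definition orthonormal_fam :: "nat \<Rightarrow> (nat \<Rightarrow> complex ^ 'n) \<Rightarrow> bool" where
  "orthonormal_fam r e \<longleftrightarrow> (\<forall>i<r. \<forall>j<r. cinner (e i) (e j) = (if i = j then 1 else 0))"

definition schmidt_decomposition ::
    "complex ^ ('m::finite \<times> 'n::finite) \<Rightarrow> nat \<Rightarrow> (nat \<Rightarrow> real)
      \<Rightarrow> (nat \<Rightarrow> complex ^ 'm) \<Rightarrow> (nat \<Rightarrow> complex ^ 'n) \<Rightarrow> bool" where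
  "schmidt_decomposition \<Psi> r s e f \<longleftrightarrow>
     (\<forall>i<r. s i > 0) \<and> orthonormal_fam r e \<and> orthonormal_fam r f \<and>
     \<Psi> = (\<Sum>i<r. s i *\<^sub>R (e i \<otimes> f i))"

definition schmidt_coeffs :: "complex ^ ('m::finite \<times> 'n::finite) \<Rightarrow> real set" where
  "schmidt_coeffs \<Psi> = {s i | r s e f i. schmidt_decomposition \<Psi> r s e f \<and> i < r}"

definition lambda_max :: "complex ^ ('m::finite \<times> 'n::finite) \<Rightarrow> real" where
  "lambda_max \<Psi> = Max ((\<lambda>s. s\<^sup>2) ` schmidt_coeffs \<Psi>)"

subsection \<open>Initial state and the Bank's measurement\<close>

definition psi :: "real \<Rightarrow> complex ^ (2 \<times> 2)" where
  "psi \<theta> = cos \<theta> *\<^sub>R (ket 0 \<otimes> ket 0) + sin \<theta> *\<^sub>R (ket 1 \<otimes> ket 1)"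

definition bell :: "complex ^ (2 \<times> 2)" where
  "bell = (1 / sqrt 2) *\<^sub>R (ket 0 \<otimes> ket 0 + ket 1 \<otimes> ket 1)"

text \<open>
  The ket \<open>psi \<theta> \<otimes> \<Omega>\<close> with its registers rearranged from \<open>A B, A' B' K\<close> to \<open>(A A') (B B'), K\<close>.
\<close>

definition initial_state ::
    "real \<Rightarrow> complex ^ ('a::finite \<times> 'b::finite \<times> 'k::finite)
      \<Rightarrow> complex ^ (((2 \<times> 'a) \<times> (2 \<times> 'b)) \<times> 'k)" where
  "initial_state \<theta> \<Omega> =
     (\<chi> i. case i of (((a, a'), (b, b')), k) \<Rightarrow> psi \<theta> $ (a, b) * \<Omega> $ (a', b', k))"

definition povm :: "nat \<Rightarrow> (nat \<Rightarrow> complex ^ 'k ^ 'k) \<Rightarrow> bool" where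
  "povm n M \<longleftrightarrow> (\<Sum>m<n. adj (M m) ** M m) = mat 1"

text \<open>
  A measurement operator maps \<open>K\<close> to \<open>K\<close>, so the post-measurement ket formally still contains \<open>K\<close>.
  That outcome \<open>m\<close> leaves Alice and Bob in a pure state means that this ket is a product
  \<open>\<Psi> m \<otimes> \<kappa>\<close> with a unit ket \<open>\<kappa>\<close> of \<open>K\<close>; \<open>\<Psi> m\<close> is then their unnormalized state, determined
  up to a phase. This always holds for rank-one operators \<open>M m\<close> (in particular for a bra on \<open>K\<close>
  followed by preparation of a fixed ket).
\<close>

definition bank_measurement ::
    "real \<Rightarrow> complex ^ ('a::finite \<times> 'b::finite \<times> 'k::finite) \<Rightarrow> nat
      \<Rightarrow> (nat \<Rightarrow> complex ^ 'k ^ 'k) \<Rightarrow> (nat \<Rightarrow> complex ^ ((2 \<times> 'a) \<times> (2 \<times> 'b))) \<Rightarrow> bool" where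
  "bank_measurement \<theta> \<Omega> n M \<Psi> \<longleftrightarrow>
     povm n M \<and>
     (\<forall>m<n. \<exists>\<kappa>. norm \<kappa> = 1 \<and> (mat 1 \<otimes>\<^sub>m M m) *v initial_state \<theta> \<Omega> = \<Psi> m \<otimes> \<kappa>)"

definition outcome_prob :: "complex ^ 'n \<Rightarrow> real" where
  "outcome_prob \<Psi> = Re (cinner \<Psi> \<Psi>)"

definition normalized :: "complex ^ 'n \<Rightarrow> complex ^ 'n" where
  "normalized \<Psi> = (1 / sqrt (outcome_prob \<Psi>)) *\<^sub>R \<Psi>"

definition mu_star :: "real \<Rightarrow> complex ^ ('a::finite \<times> 'b::finite \<times> 'k::finite) \<Rightarrow> real" where
  "mu_star \<theta> \<Omega> =
     Inf {Sup {lambda_max (normalized (\<Psi> m)) | m. m < n \<and> outcome_prob (\<Psi> m) > 0}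
          | n M \<Psi>. bank_measurement \<theta> \<Omega> n M \<Psi>}"

subsection \<open>LOCC maps\<close>

text \<open>
  Finite-round LOCC maps on operators of a bipartite system: one party applies a local instrument
  and announces its outcome, and the remaining protocol depends on that outcome. One Kraus operator
  per outcome suffices, since continuations may agree on several outcomes (coarse-graining).
\<close>

inductive locc ::
    "(complex ^ ('m::finite \<times> 'n::finite) ^ ('m \<times> 'n) \<Rightarrow> complex ^ ('m \<times> 'n) ^ ('m \<times> 'n)) \<Rightarrow> bool"
  where
    stop: "locc (\<lambda>\<rho>. \<rho>)"
  | alice: "(\<Sum>i<(r::nat). adj (E i) ** E i) = mat 1 \<Longrightarrow> (\<And>i. i < r \<Longrightarrow> locc (\<Lambda> i)) \<Longrightarrow>
      locc (\<lambda>\<rho>. \<Sum>i<r. \<Lambda> i ((E i \<otimes>\<^sub>m mat 1) ** \<rho> ** adj (E i \<otimes>\<^sub>m mat 1)))"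
  | bob: "(\<Sum>i<(r::nat). adj (F i) ** F i) = mat 1 \<Longrightarrow> (\<And>i. i < r \<Longrightarrow> locc (\<Lambda> i)) \<Longrightarrow>
      locc (\<lambda>\<rho>. \<Sum>i<r. \<Lambda> i ((mat 1 \<otimes>\<^sub>m F i) ** \<rho> ** adj (mat 1 \<otimes>\<^sub>m F i)))"

subsection \<open>Deterministic restoration\<close>

text \<open>Alice and Bob append local ancillas \<open>'x\<close> and \<open>'y\<close>; \<open>A\<close> and \<open>B\<close> stay the first components.\<close>

definition with_ancillas ::
    "complex ^ 'x \<Rightarrow> complex ^ 'y \<Rightarrow> complex ^ ((2 \<times> 'a::finite) \<times> (2 \<times> 'b::finite))
      \<Rightarrow> complex ^ ((2 \<times> 'a \<times> 'x::finite) \<times> (2 \<times> 'b \<times> 'y::finite))" where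
  "with_ancillas \<alpha> \<beta> \<Psi> =
     (\<chi> i. case i of ((a, a', x), (b, b', y)) \<Rightarrow> \<Psi> $ ((a, a'), (b, b')) * \<alpha> $ x * \<beta> $ y)"

text \<open>Partial trace over all leftover registers, i.e. everything except \<open>A\<close> and \<open>B\<close>.\<close>

definition reduced_AB ::
    "complex ^ ((2 \<times> 'l::finite) \<times> (2 \<times> 'r::finite)) ^ ((2 \<times> 'l) \<times> (2 \<times> 'r))
      \<Rightarrow> complex ^ (2 \<times> 2) ^ (2 \<times> 2)" where
  "reduced_AB \<rho> =
     (\<chi> p q. \<Sum>l\<in>UNIV. \<Sum>r\<in>UNIV.
        \<rho> $ ((fst p, l), (snd p, r)) $ ((fst q, l), (snd q, r)))"

text \<open>
  Ancilla dimensions are types and cannot be existentially quantified inside the definition; they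
  are parameters instead. A result for arbitrary \<open>'x\<close> and \<open>'y\<close> covers all ancilla dimensions
  (one-element types amount to no ancilla).
\<close>

definition bell_restorable ::
    "'x::finite itself \<Rightarrow> 'y::finite itself
      \<Rightarrow> real \<Rightarrow> complex ^ ('a::finite \<times> 'b::finite \<times> 'k::finite) \<Rightarrow> bool" where
  "bell_restorable _ _ \<theta> \<Omega> \<longleftrightarrow>
     (\<exists>n M \<Psi>. bank_measurement \<theta> \<Omega> n M \<Psi> \<and>
        (\<forall>m<n. outcome_prob (\<Psi> m) > 0 \<longrightarrow>
           (\<exists>(\<alpha> :: complex ^ 'x) (\<beta> :: complex ^ 'y) \<Lambda>.
              norm \<alpha> = 1 \<and> norm \<beta> = 1 \<and> locc \<Lambda> \<and>
              reduced_AB (\<Lambda> (proj (with_ancillas \<alpha> \<beta> (normalized (\<Psi> m))))) = proj bell)))"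

end

theory Submission imports Defs begin

text \<open>
  Call the largest overlap of a state with unit product vectors its product overlap; its square is
  the largest squared Schmidt coefficient. Under LOCC the squared product overlap of the initial
  state is at most the sum of those of the unnormalized branch states, because a local instrument
  preserves the norm of the partial inner product with the other party's vector. Since a Bell pair
  with leftovers has product overlap squared at most 1/2, restoration forces \<open>lambda_max \<le> 1/2\<close> in every
  branch. Conversely, a spectrum bounded by 1/2 is a mixture of uniform distributions on two points,
  and Nielsen's protocol for this mixture produces a Bell pair. Finally, the infimum in
  \<open>mu_star\<close> is attained by a separation and compactness argument on the cone of admissible effects.
\<close>

subsection \<open>The Hermitian inner product\<close>

text \<open>The product overlap replaces the Schmidt coefficients because it splits into two partial
  inner products: each party's round then concerns a single local vector, where Kraus completeness
  is an exact identity. Pure states suffice throughout, since a round maps a projection to a sum of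
  projections. As the target is pure, every leaf of a restoring protocol carries the Bell pair
  separately, for its weight outside the Bell pair is a sum of nonnegative terms. The constant 1/2
  arises because a Bell pair duplicates each Schmidt vector of the leftovers, halving their squared
  coefficients.

  The obstacle in the converse is that \<open>mu_star\<close> is an infimum over POVMs with
  unboundedly many outcomes, hence not over a compact set, and that the admissible operators need
  not form a convex set. Only the effects are therefore convexified. A point of their hull still
  yields admissible operators one by one, and a separating functional singles out one operator from
  each POVM, to which compactness applies.\<close>

lemma sum_UNIV_prod: "(\<Sum>p\<in>UNIV. f p) = (\<Sum>i\<in>UNIV. \<Sum>j\<in>UNIV. f (i, j))"
  unfolding sum.cartesian_product by simp

lemma cnj_cinner: "cnj (cinner u v) = cinner v u"
  by (simp add: cinner_def mult.commute)

lemma cinner_add_right: "cinner u (v + w) = cinner u v + cinner u w"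
  by (simp add: cinner_def distrib_left sum.distrib)

lemma cinner_add_left: "cinner (u + v) w = cinner u w + cinner v w"
  by (simp add: cinner_def distrib_right sum.distrib)

lemma cinner_diff_right: "cinner u (v - w) = cinner u v - cinner u w"
  by (simp add: cinner_def right_diff_distrib sum_subtractf)

lemma cinner_diff_left: "cinner (u - v) w = cinner u w - cinner v w"
  by (simp add: cinner_def left_diff_distrib sum_subtractf)

lemma cinner_zero [simp]: "cinner u 0 = 0" "cinner 0 u = 0"
  by (simp_all add: cinner_def)

lemma cinner_scale_right: "cinner u (c *s v) = c * cinner u v"
  by (simp add: cinner_def sum_distrib_left mult.left_commute)

lemma cinner_scale_left: "cinner (c *s u) v = cnj c * cinner u v"
  by (simp add: cinner_def sum_distrib_left mult.assoc)

lemma cinner_scaleR_right: "cinner u (c *\<^sub>R v) = of_real c * cinner u v"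
  by (simp add: cinner_def scaleR_conv_of_real[where 'a = complex] sum_distrib_left mult.left_commute)

lemma cinner_scaleR_left: "cinner (c *\<^sub>R u) v = of_real c * cinner u v"
  by (simp add: cinner_def scaleR_conv_of_real[where 'a = complex] sum_distrib_left mult.assoc)

lemma cinner_sum_right: "cinner u (sum f S) = (\<Sum>i\<in>S. cinner u (f i))"
  by (induction S rule: infinite_finite_induct) (auto simp: cinner_add_right)

lemma cinner_sum_left: "cinner (sum f S) u = (\<Sum>i\<in>S. cinner (f i) u)"
  by (induction S rule: infinite_finite_induct) (auto simp: cinner_add_left)

lemmas cinner_linear =
  cinner_add_right cinner_add_left cinner_diff_right cinner_diff_left
  cinner_scale_right cinner_scale_left cinner_scaleR_right cinner_scaleR_left
  cinner_sum_right cinner_sum_left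

lemma norm_sq_vec: "(norm u)\<^sup>2 = (\<Sum>i\<in>UNIV. (norm (u $ i))\<^sup>2)"
  by (simp add: norm_vec_def L2_set_def sum_nonneg)

lemma cinner_self: "cinner u u = of_real ((norm u)\<^sup>2)"
  unfolding norm_sq_vec cinner_def
  by (simp add: complex_norm_square mult.commute del: of_real_power)

lemma Re_cinner: "Re (cinner u v) = u \<bullet> v"
  by (simp add: cinner_def inner_vec_def inner_complex_def)

lemma outcome_prob_eq: "outcome_prob u = (norm u)\<^sup>2"
  by (simp add: outcome_prob_def cinner_self)

lemma norm_scale: "norm (c *s u) = norm c * norm (u :: complex ^ 'n)"
proof -
  have "(norm (c *s u))\<^sup>2 = (norm c * norm u)\<^sup>2"
    by (simp add: norm_sq_vec power_mult_distrib norm_mult sum_distrib_left)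
  then show ?thesis by (simp add: power2_eq_iff_nonneg)
qed

text \<open>The phase \<open>z\<close> applied to \<open>u\<close> makes the inner product real and
  nonnegative, which reduces the claim to Cauchy-Schwarz for the real inner product.\<close>

lemma cinner_Cauchy_Schwarz: "norm (cinner u v) \<le> norm u * norm v"
proof -
  define z where "z = sgn (cinner u v)"
  have "cnj z * cinner u v = of_real (norm (cinner u v))"
    using complex_norm_square[of "cinner u v"]
    by (cases "cinner u v = 0") (simp_all add: z_def sgn_eq mult.commute power2_eq_square divide_eq_eq)
  then have "norm (cinner u v) = Re (cnj z * cinner u v)"
    by simp
  also have "\<dots> = (z *s u) \<bullet> v"
    by (simp add: cinner_scale_left flip: Re_cinner)
  also have "\<dots> \<le> norm (z *s u) * norm v"
    by (rule norm_cauchy_schwarz)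
  also have "\<dots> \<le> norm u * norm v"
    by (cases "cinner u v = 0") (auto simp: norm_scale z_def norm_sgn)
  finally show ?thesis .
qed

lemma cinner_ket: "cinner (ket i) v = v $ i"
proof -
  have "cinner (ket i) v = (\<Sum>j\<in>UNIV. if j = i then v $ j else 0)"
    unfolding cinner_def by (intro sum.cong) (auto simp: ket_def axis_def)
  then show ?thesis by simp
qed

lemma norm_ket [simp]: "norm (ket i) = 1"
  by (simp add: ket_def)

section \<open>Adjoints and Kraus completeness\<close>

lemma cinner_adj: "cinner u (A *v v) = cinner (adj A *v u) v"
proof -
  have "cinner u (A *v v) = (\<Sum>i\<in>UNIV. \<Sum>j\<in>UNIV. cnj (u $ i) * (A $ i $ j * v $ j))"
    by (simp add: cinner_def matrix_vector_mult_def sum_distrib_left)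
  also have "\<dots> = (\<Sum>j\<in>UNIV. \<Sum>i\<in>UNIV. cnj (u $ i) * (A $ i $ j * v $ j))"
    by (rule sum.swap)
  also have "\<dots> = cinner (adj A *v u) v"
    by (simp add: cinner_def matrix_vector_mult_def sum_distrib_right sum_distrib_left adj_def mult_ac)
  finally show ?thesis .
qed

lemma adj_adj [simp]: "adj (adj A) = A"
  by (simp add: adj_def vec_eq_iff)

lemma adj_add: "adj (A + B) = adj A + adj B"
  by (simp add: adj_def vec_eq_iff)

lemma adj_diff: "adj (A - B) = adj A - adj B"
  by (simp add: adj_def vec_eq_iff)

lemma adj_zero: "adj 0 = 0"
  by (simp add: adj_def vec_eq_iff)

lemma adj_sum: "adj (sum f S) = (\<Sum>i\<in>S. adj (f i))"
  by (induction S rule: infinite_finite_induct) (auto simp: adj_add adj_zero)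

lemma adj_scaleR: "adj (c *\<^sub>R A) = c *\<^sub>R adj A"
  by (simp add: adj_def vec_eq_iff scaleR_conv_of_real[where 'a = complex])

lemma adj_mat: "adj (mat 1) = mat 1"
  by (auto simp: adj_def mat_def vec_eq_iff)

lemma sum_matrix_vector_mult: "sum A S *v x = (\<Sum>i\<in>S. A i *v x)"
  by (induction S rule: infinite_finite_induct) (auto simp: matrix_vector_mult_add_rdistrib)

lemma scaleR_matrix_vector_mult: "(c *\<^sub>R A) *v x = c *\<^sub>R (A *v x)" for A :: "complex ^ 'n ^ 'm"
  by (simp add: vec_eq_iff matrix_vector_mult_def scaleR_sum_right)

lemma matrix_vector_mult_scaleR: "A *v (c *\<^sub>R x) = c *\<^sub>R (A *v x)" for A :: "complex ^ 'n ^ 'm"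
  by (simp add: vec_eq_iff matrix_vector_mult_def scaleR_sum_right)

text \<open>Conservation of total probability, stated for an arbitrary vector because it is applied
  below to partial inner products rather than to full states.\<close>

lemma sum_norm_kraus:
  assumes "(\<Sum>i\<in>S. adj (E i) ** E i) = mat 1"
  shows "(\<Sum>i\<in>S. (norm (E i *v w))\<^sup>2) = (norm w)\<^sup>2"
proof -
  have "complex_of_real (\<Sum>i\<in>S. (norm (E i *v w))\<^sup>2) = (\<Sum>i\<in>S. cinner (E i *v w) (E i *v w))"
    by (simp add: cinner_self)
  also have "\<dots> = cinner w ((\<Sum>i\<in>S. adj (E i) ** E i) *v w)"
    by (simp add: sum_matrix_vector_mult cinner_sum_right cinner_adj[of w "adj _"]
        flip: matrix_vector_mul_assoc)
  also have "\<dots> = of_real ((norm w)\<^sup>2)"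
    by (simp add: assms cinner_self)
  finally show ?thesis by (simp only: of_real_eq_iff)
qed

lemma proj_conj: "A ** proj v ** adj A = proj (A *v v)"
  unfolding vec_eq_iff proj_def matrix_matrix_mult_def matrix_vector_mult_def adj_def
  by (auto simp: sum_distrib_left sum_distrib_right mult_ac intro!: sum.swap)

subsection \<open>Partial inner products and the largest Schmidt coefficient\<close>

text \<open>The bra of \<open>u\<close> acting on the left factor; \<open>contr_right\<close> is the
  mirror image. An overlap with a product vector can be evaluated by contracting either side first,
  and many arguments below compare the two orders.\<close>

definition contr_left :: "complex ^ 'm \<Rightarrow> complex ^ ('m::finite \<times> 'n::finite) \<Rightarrow> complex ^ 'n" where
  "contr_left u \<Phi> = (\<chi> j. \<Sum>i\<in>UNIV. cnj (u $ i) * \<Phi> $ (i, j))"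

definition contr_right :: "complex ^ 'n \<Rightarrow> complex ^ ('m::finite \<times> 'n::finite) \<Rightarrow> complex ^ 'm" where
  "contr_right v \<Phi> = (\<chi> i. \<Sum>j\<in>UNIV. cnj (v $ j) * \<Phi> $ (i, j))"

lemma cinner_tensor_right: "cinner (u \<otimes> v) \<Phi> = cinner u (contr_right v \<Phi>)"
  by (simp add: cinner_def contr_right_def ket_tensor_def sum_UNIV_prod sum_distrib_left mult_ac)

lemma cinner_tensor_left: "cinner (u \<otimes> v) \<Phi> = cinner v (contr_left u \<Phi>)"
  by (simp add: cinner_def contr_left_def ket_tensor_def sum_UNIV_prod sum_distrib_left mult_ac)
    (rule sum.swap)

text \<open>The homogeneous form covers zero and unnormalised vectors, so branch states need no
  normalisation and their bounds can simply be added.\<close>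

definition overlap_bound :: "complex ^ ('m::finite \<times> 'n::finite) \<Rightarrow> real \<Rightarrow> bool" where
  "overlap_bound \<Phi> c \<longleftrightarrow>
     (\<forall>u v. (norm (cinner (u \<otimes> v) \<Phi>))\<^sup>2 \<le> c * (norm u)\<^sup>2 * (norm v)\<^sup>2)"

lemma contr_right_diff: "contr_right v (\<Phi> - \<Phi>') = contr_right v \<Phi> - contr_right v \<Phi>'"
  by (simp add: contr_right_def vec_eq_iff right_diff_distrib sum_subtractf)

lemma contr_left_diff: "contr_left v (\<Phi> - \<Phi>') = contr_left v \<Phi> - contr_left v \<Phi>'"
  by (simp add: contr_left_def vec_eq_iff right_diff_distrib sum_subtractf)

lemma contr_right_scaleR: "contr_right v (c *\<^sub>R \<Phi>) = c *\<^sub>R contr_right v \<Phi>"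
  by (simp add: contr_right_def vec_eq_iff scaleR_sum_right)

lemma contr_left_scaleR: "contr_left v (c *\<^sub>R \<Phi>) = c *\<^sub>R contr_left v \<Phi>"
  by (simp add: contr_left_def vec_eq_iff scaleR_sum_right)

lemma contr_right_add: "contr_right v (\<Phi> + \<Phi>') = contr_right v \<Phi> + contr_right v \<Phi>'"
  by (simp add: contr_right_def vec_eq_iff distrib_left sum.distrib)

lemma contr_left_add: "contr_left v (\<Phi> + \<Phi>') = contr_left v \<Phi> + contr_left v \<Phi>'"
  by (simp add: contr_left_def vec_eq_iff distrib_left sum.distrib)

lemma contr_right_0: "contr_right v 0 = 0"
  by (simp add: contr_right_def vec_eq_iff)

lemma contr_left_0: "contr_left v 0 = 0"
  by (simp add: contr_left_def vec_eq_iff)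

lemma contr_right_sum: "contr_right v (sum F S) = (\<Sum>i\<in>S. contr_right v (F i))"
  by (induction S rule: infinite_finite_induct) (auto simp: contr_right_add contr_right_0)

lemma contr_left_sum: "contr_left v (sum F S) = (\<Sum>i\<in>S. contr_left v (F i))"
  by (induction S rule: infinite_finite_induct) (auto simp: contr_left_add contr_left_0)

lemma contr_right_tensor: "contr_right v (e \<otimes> f) = cinner v f *s e"
  by (simp add: contr_right_def ket_tensor_def cinner_def vec_eq_iff sum_distrib_left mult_ac)

lemma contr_left_tensor: "contr_left u (e \<otimes> f) = cinner u e *s f"
  by (simp add: contr_left_def ket_tensor_def cinner_def vec_eq_iff sum_distrib_left mult_ac)

text \<open>The contraction itself is the best test vector on the left; dividing by its squared norm
  gives the bound. If it vanishes, the right-hand side still has to be nonnegative, which testing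
  against any basis ket shows.\<close>

lemma contr_right_norm_le:
  assumes "overlap_bound \<Phi> c"
  shows "(norm (contr_right v \<Phi>))\<^sup>2 \<le> c * (norm v)\<^sup>2"
proof (cases "contr_right v \<Phi> = 0")
  case True
  from assms have "0 \<le> c * (norm (ket undefined :: complex ^ 'a))\<^sup>2 * (norm v)\<^sup>2"
    unfolding overlap_bound_def by (meson order_trans zero_le_power2)
  with True show ?thesis by simp
next
  case False
  let ?w = "contr_right v \<Phi>"
  have "((norm ?w)\<^sup>2)\<^sup>2 \<le> c * (norm ?w)\<^sup>2 * (norm v)\<^sup>2"
    using assms[unfolded overlap_bound_def, rule_format, of ?w v]
    by (simp add: cinner_tensor_right cinner_self norm_power)
  then have "(norm ?w)\<^sup>2 * (norm ?w)\<^sup>2 \<le> (norm ?w)\<^sup>2 * (c * (norm v)\<^sup>2)"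
    by (simp add: power2_eq_square mult_ac)
  with False show ?thesis by (simp only: mult_le_cancel_left) auto
qed

lemma contr_left_norm_le:
  assumes "overlap_bound \<Phi> c"
  shows "(norm (contr_left u \<Phi>))\<^sup>2 \<le> c * (norm u)\<^sup>2"
proof (cases "contr_left u \<Phi> = 0")
  case True
  from assms have "0 \<le> c * (norm u)\<^sup>2 * (norm (ket undefined :: complex ^ 'b))\<^sup>2"
    unfolding overlap_bound_def by (meson order_trans zero_le_power2)
  with True show ?thesis by simp
next
  case False
  let ?w = "contr_left u \<Phi>"
  have "((norm ?w)\<^sup>2)\<^sup>2 \<le> c * (norm u)\<^sup>2 * (norm ?w)\<^sup>2"
    using assms[unfolded overlap_bound_def, rule_format, of u ?w]
    by (simp add: cinner_tensor_left cinner_self norm_power)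
  then have "(norm ?w)\<^sup>2 * (norm ?w)\<^sup>2 \<le> (norm ?w)\<^sup>2 * (c * (norm u)\<^sup>2)"
    by (simp add: power2_eq_square mult_ac)
  with False show ?thesis by (simp only: mult_le_cancel_left) auto
qed

section \<open>Maximal overlaps and singular pairs\<close>

lemma continuous_on_cinner_tensor:
  "continuous_on S (\<lambda>p. cinner (fst p \<otimes> snd p) \<Phi>)"
  unfolding cinner_def ket_tensor_def
  by (simp add: sum_UNIV_prod) (intro continuous_intros)

text \<open>A continuous function attains its maximum on the compact product of the unit spheres,
  and homogeneity extends the bound to all vectors.\<close>

lemma overlap_maximiser:
  obtains u v where "norm u = 1" "norm v = 1" "overlap_bound \<Phi> ((norm (cinner (u \<otimes> v) \<Phi>))\<^sup>2)"
proof -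
  let ?S = "sphere 0 1 \<times> sphere 0 1 :: ((complex ^ 'a) \<times> (complex ^ 'b)) set"
  have "compact ?S" by (intro compact_Times compact_sphere)
  moreover have "?S \<noteq> {}"
  proof -
    have "(ket undefined, ket undefined) \<in> ?S" by simp
    then show ?thesis by blast
  qed
  moreover have "continuous_on ?S (\<lambda>p. norm (cinner (fst p \<otimes> snd p) \<Phi>))"
    by (intro continuous_on_norm continuous_on_cinner_tensor)
  ultimately obtain p where p: "p \<in> ?S"
    and max: "\<And>q. q \<in> ?S \<Longrightarrow> norm (cinner (fst q \<otimes> snd q) \<Phi>) \<le> norm (cinner (fst p \<otimes> snd p) \<Phi>)"
    by (meson continuous_attains_sup)
  obtain u v where uv: "p = (u, v)" by fastforce
  have "(norm (cinner (x \<otimes> y) \<Phi>))\<^sup>2 \<le> (norm (cinner (u \<otimes> v) \<Phi>))\<^sup>2 * (norm x)\<^sup>2 * (norm y)\<^sup>2" for x y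
  proof (cases "x = 0 \<or> y = 0")
    case True
    then have "cinner (x \<otimes> y) \<Phi> = 0"
      using cinner_tensor_right[of x y \<Phi>] cinner_tensor_left[of x y \<Phi>] by auto
    then show ?thesis by simp
  next
    case False
    then have "norm (cinner (((1 / norm x) *\<^sub>R x) \<otimes> ((1 / norm y) *\<^sub>R y)) \<Phi>)
        \<le> norm (cinner (u \<otimes> v) \<Phi>)"
      using max[of "((1 / norm x) *\<^sub>R x, (1 / norm y) *\<^sub>R y)"] by (simp add: uv)
    moreover have "cinner (((1 / norm x) *\<^sub>R x) \<otimes> ((1 / norm y) *\<^sub>R y)) \<Phi>
        = of_real (1 / norm x) * (of_real (1 / norm y) * cinner (x \<otimes> y) \<Phi>)"
      by (metis cinner_tensor_right cinner_tensor_left cinner_scaleR_left)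
    ultimately have "norm (cinner (x \<otimes> y) \<Phi>) \<le> norm (cinner (u \<otimes> v) \<Phi>) * norm x * norm y"
      using False by (simp add: norm_mult norm_divide field_simps)
    then have "(norm (cinner (x \<otimes> y) \<Phi>))\<^sup>2 \<le> (norm (cinner (u \<otimes> v) \<Phi>) * norm x * norm y)\<^sup>2"
      by (rule power_mono) simp
    then show ?thesis by (simp add: power_mult_distrib)
  qed
  with p uv show thesis
    by (intro that[of u v]) (auto simp: overlap_bound_def)
qed

text \<open>Contracting with basis kets reads off the entries of \<Phi>.\<close>

lemma overlap_bound_0_iff: "overlap_bound \<Phi> 0 \<longleftrightarrow> \<Phi> = 0"
proof
  assume "overlap_bound \<Phi> 0"
  then have "contr_right (ket j) \<Phi> = 0" for j
    using contr_right_norm_le[of \<Phi> 0 "ket j"] by simp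
  moreover have "contr_right (ket j) \<Phi> $ i = \<Phi> $ (i, j)" for i j
    using cinner_ket[of j "\<chi> j. \<Phi> $ (i, j)"] by (simp add: contr_right_def cinner_def)
  ultimately show "\<Phi> = 0" by (metis (no_types, lifting) surj_pair vec_eq_iff zero_index)
qed (simp add: overlap_bound_def)

text \<open>Equality case of Cauchy-Schwarz: the component of \<open>w\<close> along
  \<open>u\<close> already exhausts its norm, so nothing is left orthogonal to
  \<open>u\<close>.\<close>

lemma eq_scaleR_if_cinner_eq:
  assumes "cinner u w = of_real s" "norm u = 1" "norm w \<le> s"
  shows "w = s *\<^sub>R u"
proof -
  have "u \<bullet> w = s" "u \<bullet> u = 1"
    using assms(1,2) by (simp_all add: norm_eq_1 flip: Re_cinner)
  then have "(norm (w - s *\<^sub>R u))\<^sup>2 = (norm w)\<^sup>2 - s\<^sup>2"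
    by (simp add: power2_norm_eq_inner inner_diff_left inner_diff_right inner_commute[of w u]
        power2_eq_square[of s])
  also have "\<dots> \<le> 0"
    using assms(3) by (simp add: power_mono)
  finally show ?thesis by simp
qed

text \<open>
  A maximiser \<open>u, v\<close> of the overlap is a pair of singular vectors: the contraction of \<open>\<Phi>\<close> with
  \<open>v\<close> has norm at most the maximum \<open>s\<close>, which is already its component along \<open>u\<close>.
\<close>

lemma singular_pair:
  assumes "\<Phi> \<noteq> 0"
  obtains s u v where "s > 0" "norm u = 1" "norm v = 1" "overlap_bound \<Phi> (s\<^sup>2)"
    "contr_right v \<Phi> = s *\<^sub>R u" "contr_left u \<Phi> = s *\<^sub>R v"
proof -
  obtain u' v where u': "norm u' = 1" and v: "norm v = 1"
    and bd: "overlap_bound \<Phi> ((norm (cinner (u' \<otimes> v) \<Phi>))\<^sup>2)"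
    by (rule overlap_maximiser)
  define s where "s = norm (cinner (u' \<otimes> v) \<Phi>)"
  \<comment> \<open>The phase of the overlap is absorbed into \<open>u\<close>, so that the overlap
    becomes the positive real \<open>s\<close>.\<close>
  define u where "u = sgn (cinner (u' \<otimes> v) \<Phi>) *s u'"
  have s: "s > 0"
    using bd assms overlap_bound_0_iff by (fastforce simp: s_def)
  then have u: "norm u = 1"
    using u' by (auto simp: u_def norm_scale norm_sgn s_def)
  have "cinner (u \<otimes> v) \<Phi> = cnj (sgn (cinner (u' \<otimes> v) \<Phi>)) * cinner (u' \<otimes> v) \<Phi>"
    by (simp add: u_def cinner_tensor_right cinner_scale_left)
  also have "\<dots> = of_real s"
    using s complex_norm_square[of "cinner (u' \<otimes> v) \<Phi>"]
    by (simp add: s_def sgn_eq mult.commute power2_eq_square divide_eq_eq)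
  finally have uv: "cinner (u \<otimes> v) \<Phi> = of_real s" .
  have bd': "overlap_bound \<Phi> (s\<^sup>2)" using bd by (simp add: s_def)
  have "contr_right v \<Phi> = s *\<^sub>R u"
    using uv u contr_right_norm_le[OF bd', of v] v s
    by (intro eq_scaleR_if_cinner_eq) (auto simp: cinner_tensor_right intro: power2_le_imp_le)
  moreover have "contr_left u \<Phi> = s *\<^sub>R v"
    using uv v contr_left_norm_le[OF bd', of u] u s
    by (intro eq_scaleR_if_cinner_eq) (auto simp: cinner_tensor_left intro: power2_le_imp_le)
  ultimately show thesis using that s u v bd' by blast
qed

section \<open>Peeling off a Schmidt decomposition\<close>

lemma orthonormal_fam_Suc:
  assumes "orthonormal_fam r e" "norm u = 1" "\<And>i. i < r \<Longrightarrow> cinner (e i) u = 0"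
  shows "orthonormal_fam (Suc r) (e(r := u))"
proof -
  have "cinner u (e i) = 0" if "i < r" for i
    using assms(3)[OF that] cnj_cinner[of "e i" u] by simp
  then show ?thesis
    using assms by (auto simp: orthonormal_fam_def less_Suc_eq cinner_self)
qed

text \<open>Hermitian orthogonality implies real orthogonality, hence real independence. The bound
  is the real dimension, twice the complex one, which is enough to terminate the peeling.\<close>

lemma orthonormal_fam_le_DIM:
  assumes "orthonormal_fam r (e :: nat \<Rightarrow> complex ^ 'n)"
  shows "r \<le> DIM(complex ^ 'n)"
proof -
  have inj: "inj_on e {..<r}"
    using assms by (auto simp: orthonormal_fam_def inj_on_def) (metis zero_neq_one)
  have "e i \<noteq> 0" if "i < r" for i
    using assms that by (auto simp: orthonormal_fam_def) (metis cinner_zero(1) zero_neq_one)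
  moreover have "pairwise orthogonal (e ` {..<r})"
    using assms by (auto simp: pairwise_def orthogonal_def orthonormal_fam_def simp flip: Re_cinner)
  ultimately have "independent (e ` {..<r})"
    by (intro pairwise_orthogonal_independent) auto
  then have "card (e ` {..<r}) \<le> DIM(complex ^ 'n)"
    using independent_bound by blast
  then show ?thesis by (simp add: card_image inj)
qed

text \<open>An unfinished decomposition. The invariant is that the residual is annihilated by the
  vectors already chosen on either side; this makes every later singular pair orthogonal to
  them.\<close>

definition schmidt_partial where
  "schmidt_partial \<Phi> r s e f \<longleftrightarrow>
     (\<forall>i<r. s i > 0) \<and> orthonormal_fam r e \<and> orthonormal_fam r f \<and>
     (\<forall>i<r. contr_left (e i) (\<Phi> - (\<Sum>i<r. s i *\<^sub>R (e i \<otimes> f i))) = 0 \<and>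
            contr_right (f i) (\<Phi> - (\<Sum>i<r. s i *\<^sub>R (e i \<otimes> f i))) = 0)"

lemma schmidt_partial_Suc:
  assumes part: "schmidt_partial \<Phi> r s e f"
    and \<Phi>': "\<Phi>' = \<Phi> - (\<Sum>i<r. s i *\<^sub>R (e i \<otimes> f i))"
    and t: "t > 0" "norm u = 1" "norm v = 1"
      "contr_right v \<Phi>' = t *\<^sub>R u" "contr_left u \<Phi>' = t *\<^sub>R v"
  shows "schmidt_partial \<Phi> (Suc r) (s(r := t)) (e(r := u)) (f(r := v))"
proof -
  have e: "contr_left (e i) \<Phi>' = 0" and f: "contr_right (f i) \<Phi>' = 0" if "i < r" for i
    using part that by (simp_all add: schmidt_partial_def \<Phi>')
  have eu: "cinner (e i) u = 0" if "i < r" for i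
  proof -
    \<comment> \<open>The overlap of the residual with \<open>e i \<otimes> v\<close> is evaluated
      in both orders: contracting \<open>v\<close> first gives the left-hand side, contracting
      \<open>e i\<close> first gives 0.\<close>
    have "of_real t * cinner (e i) u = cinner (e i \<otimes> v) \<Phi>'"
      by (simp add: cinner_tensor_right t cinner_scaleR_right)
    also have "\<dots> = 0" by (simp add: cinner_tensor_left e[OF that])
    finally show ?thesis using t by simp
  qed
  have fv: "cinner (f i) v = 0" if "i < r" for i
  proof -
    have "of_real t * cinner (f i) v = cinner (u \<otimes> f i) \<Phi>'"
      by (simp add: cinner_tensor_left t cinner_scaleR_right)
    also have "\<dots> = 0" by (simp add: cinner_tensor_right f[OF that])
    finally show ?thesis using t by simp
  qed
  have res: "\<Phi> - (\<Sum>i<Suc r. (s(r := t)) i *\<^sub>R ((e(r := u)) i \<otimes> (f(r := v)) i)) = \<Phi>' - t *\<^sub>R (u \<otimes> v)"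
    by (simp add: \<Phi>')
  have "contr_left ((e(r := u)) i) (\<Phi>' - t *\<^sub>R (u \<otimes> v)) = 0 \<and>
        contr_right ((f(r := v)) i) (\<Phi>' - t *\<^sub>R (u \<otimes> v)) = 0" if "i < Suc r" for i
    using that e f eu fv t
    by (auto simp: less_Suc_eq contr_left_diff contr_right_diff contr_left_scaleR contr_right_scaleR
        contr_left_tensor contr_right_tensor cinner_self)
  moreover have "orthonormal_fam (Suc r) (e(r := u))" "orthonormal_fam (Suc r) (f(r := v))"
    using part t eu fv by (auto simp: schmidt_partial_def intro!: orthonormal_fam_Suc)
  moreover have "\<forall>i<Suc r. (s(r := t)) i > 0"
    using part t by (auto simp: schmidt_partial_def less_Suc_eq)
  ultimately show ?thesis
    unfolding schmidt_partial_def res by blast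
qed

text \<open>Singular pairs of the residual are split off until it is zero; the dimension bounds the
  number of steps. Coefficients already chosen are kept, so a maximal first one survives to the
  end.\<close>

lemma schmidt_partial_extend:
  fixes \<Phi> :: "complex ^ ('m::finite \<times> 'n::finite)"
  assumes "schmidt_partial \<Phi> r s e f"
  shows "\<exists>r' s' e' f'. r \<le> r' \<and> (\<forall>i<r. s' i = s i) \<and> schmidt_decomposition \<Phi> r' s' e' f'"
  using assms
proof (induction "DIM(complex ^ 'm) - r" arbitrary: r s e f rule: less_induct)
  case less
  define \<Phi>' where "\<Phi>' = \<Phi> - (\<Sum>i<r. s i *\<^sub>R (e i \<otimes> f i))"
  show ?case
  proof (cases "\<Phi>' = 0")
    case True
    then have "schmidt_decomposition \<Phi> r s e f"
      using less.prems by (simp add: schmidt_decomposition_def schmidt_partial_def \<Phi>'_def)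
    then show ?thesis by blast
  next
    case False
    then obtain t u v where t: "t > 0" "norm u = 1" "norm v = 1"
      "contr_right v \<Phi>' = t *\<^sub>R u" "contr_left u \<Phi>' = t *\<^sub>R v"
      using singular_pair by blast
    have part: "schmidt_partial \<Phi> (Suc r) (s(r := t)) (e(r := u)) (f(r := v))"
      by (rule schmidt_partial_Suc[OF less.prems \<Phi>'_def t])
    then have "Suc r \<le> DIM(complex ^ 'm)"
      by (meson orthonormal_fam_le_DIM schmidt_partial_def)
    then have "DIM(complex ^ 'm) - Suc r < DIM(complex ^ 'm) - r" by linarith
    from less.hyps[OF this part] obtain r' s' e' f' where
      "Suc r \<le> r'" "\<forall>i<Suc r. s' i = (s(r := t)) i" "schmidt_decomposition \<Phi> r' s' e' f'"
      by blast
    then show ?thesis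
      by (intro exI[of _ r'] exI[of _ s'] exI[of _ e'] exI[of _ f']) auto
  qed
qed

lemma schmidt_exists_max:
  fixes \<Phi> :: "complex ^ ('m::finite \<times> 'n::finite)"
  assumes "\<Phi> \<noteq> 0"
  obtains r s e f where "schmidt_decomposition \<Phi> r s e f" "r > 0" "overlap_bound \<Phi> ((s 0)\<^sup>2)"
proof -
  obtain t u v where t: "t > 0" "norm u = 1" "norm v = 1"
      "contr_right v \<Phi> = t *\<^sub>R u" "contr_left u \<Phi> = t *\<^sub>R v" and bd: "overlap_bound \<Phi> (t\<^sup>2)"
    using singular_pair[OF assms] by metis
  \<comment> \<open>The peeling starts with a maximiser of the overlap of \<Phi> itself, which
    places the largest coefficient at index 0.\<close>
  have "schmidt_partial \<Phi> 0 (\<lambda>_. 0) (\<lambda>_. 0) (\<lambda>_. 0)"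
    by (simp add: schmidt_partial_def orthonormal_fam_def)
  from schmidt_partial_Suc[OF this _ t]
  have "schmidt_partial \<Phi> (Suc 0) ((\<lambda>_. 0)(0 := t)) ((\<lambda>_. 0)(0 := u)) ((\<lambda>_. 0)(0 := v))"
    by simp
  from schmidt_partial_extend[OF this] obtain r' s' e' f' where
      "Suc 0 \<le> r'" "s' 0 = t" "schmidt_decomposition \<Phi> r' s' e' f'"
    by auto
  with bd show thesis by (intro that[of r' s' e' f']) auto
qed

section \<open>Schmidt coefficients as singular values\<close>

lemma sum_delta_fam:
  fixes x :: "nat \<Rightarrow> complex ^ 'n"
  assumes "j < r"
  shows "(\<Sum>i<r. s i *\<^sub>R ((if i = j then 1 else 0) *s x i)) = s j *\<^sub>R x j"
proof -
  have "(\<Sum>i<r. s i *\<^sub>R ((if i = j then 1 else 0) *s x i)) = (\<Sum>i<r. if i = j then s i *\<^sub>R x i else 0)"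
    by (intro sum.cong) auto
  also have "\<dots> = s j *\<^sub>R x j" using assms by simp
  finally show ?thesis .
qed

lemma schmidt_contr:
  assumes "schmidt_decomposition \<Phi> r s e f" "j < r"
  shows "contr_right (f j) \<Phi> = s j *\<^sub>R e j" "contr_left (e j) \<Phi> = s j *\<^sub>R f j"
proof -
  have on: "cinner (e j) (e i) = (if i = j then 1 else 0)"
    "cinner (f j) (f i) = (if i = j then 1 else 0)" if "i < r" for i
    using assms that by (auto simp: schmidt_decomposition_def orthonormal_fam_def)
  have \<Phi>: "\<Phi> = (\<Sum>i<r. s i *\<^sub>R (e i \<otimes> f i))"
    using assms by (simp add: schmidt_decomposition_def)
  have "contr_right (f j) \<Phi> = (\<Sum>i<r. s i *\<^sub>R (cinner (f j) (f i) *s e i))"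
    by (subst \<Phi>) (simp add: contr_right_sum contr_right_scaleR contr_right_tensor)
  also have "\<dots> = (\<Sum>i<r. s i *\<^sub>R ((if i = j then 1 else 0) *s e i))"
    using on by (intro sum.cong) simp_all
  finally show "contr_right (f j) \<Phi> = s j *\<^sub>R e j" using assms(2) by (simp add: sum_delta_fam)
  have "contr_left (e j) \<Phi> = (\<Sum>i<r. s i *\<^sub>R (cinner (e j) (e i) *s f i))"
    by (subst \<Phi>) (simp add: contr_left_sum contr_left_scaleR contr_left_tensor)
  also have "\<dots> = (\<Sum>i<r. s i *\<^sub>R ((if i = j then 1 else 0) *s f i))"
    using on by (intro sum.cong) simp_all
  finally show "contr_left (e j) \<Phi> = s j *\<^sub>R f j" using assms(2) by (simp add: sum_delta_fam)
qed

text \<open>The singular pair depends on \<Phi> alone, so coefficients coming from different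
  decompositions become comparable.\<close>

lemma schmidt_coeffsE:
  assumes "t \<in> schmidt_coeffs \<Phi>"
  obtains u v where "t > 0" "norm u = 1" "norm v = 1"
    "contr_right v \<Phi> = t *\<^sub>R u" "contr_left u \<Phi> = t *\<^sub>R v"
proof -
  obtain r s e f i where d: "schmidt_decomposition \<Phi> r s e f" "i < r" and t: "t = s i"
    using assms by (auto simp: schmidt_coeffs_def)
  have "(norm (e i))\<^sup>2 = 1" "(norm (f i))\<^sup>2 = 1" "s i > 0"
    using d cinner_self[of "e i"] cinner_self[of "f i"]
    by (auto simp: schmidt_decomposition_def orthonormal_fam_def simp flip: of_real_power)
  then have "norm (e i) = 1" "norm (f i) = 1"
    by (simp_all add: power2_eq_1_iff) (smt (verit) norm_ge_zero)+
  with schmidt_contr[OF d] \<open>s i > 0\<close> show thesis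
    by (intro that[of "e i" "f i"]) (auto simp: t)
qed

text \<open>The left singular vectors of distinct coefficients are orthogonal.\<close>

lemma finite_schmidt_coeffs: "finite (schmidt_coeffs \<Phi>)"
proof -
  let ?C = "schmidt_coeffs \<Phi>"
  have "\<forall>t\<in>?C. \<exists>u v. t > 0 \<and> norm u = 1 \<and> norm v = 1 \<and>
      contr_right v \<Phi> = t *\<^sub>R u \<and> contr_left u \<Phi> = t *\<^sub>R v"
    by (blast elim: schmidt_coeffsE)
  then obtain u v where uv: "\<And>t. t \<in> ?C \<Longrightarrow> t > 0 \<and> norm (u t) = 1 \<and> norm (v t) = 1 \<and>
      contr_right (v t) \<Phi> = t *\<^sub>R u t \<and> contr_left (u t) \<Phi> = t *\<^sub>R v t"
    by metis
  \<comment> \<open>Both sides are the overlap of \<Phi> with \<open>u t' \<otimes> v t\<close>,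
    contracted in the two orders.\<close>
  have rel: "of_real t * cinner (u t') (u t) = of_real t' * cinner (v t) (v t')"
    if "t \<in> ?C" "t' \<in> ?C" for t t'
    using cinner_tensor_right[of "u t'" "v t" \<Phi>] cinner_tensor_left[of "u t'" "v t" \<Phi>] uv[OF that(1)] uv[OF that(2)]
    by (simp add: cinner_scaleR_right)
  have orth: "cinner (u t') (u t) = 0" if "t \<in> ?C" "t' \<in> ?C" "t \<noteq> t'" for t t'
  proof -
    define x y where "x = cinner (u t') (u t)" and "y = cinner (v t) (v t')"
    have 1: "of_real t * x = of_real t' * y"
      using rel[OF that(1,2)] by (simp add: x_def y_def)
    \<comment> \<open>Exchanging \<open>t\<close> and \<open>t'\<close> and conjugating gives a
      second linear equation in \<open>x\<close> and \<open>y\<close>. Eliminating \<open>y\<close>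
      leaves \<open>x\<close> multiplied by the difference of squares, which is nonzero for distinct
      positive coefficients.\<close>
    have "cnj (of_real t' * cinner (u t) (u t')) = cnj (of_real t * cinner (v t') (v t))"
      using rel[OF that(2,1)] by simp
    then have 2: "of_real t' * x = of_real t * y"
      by (simp add: x_def y_def cnj_cinner)
    have "of_real (t\<^sup>2 - t'\<^sup>2) * x = of_real t * (of_real t * x) - of_real t' * (of_real t' * x)"
      by (simp add: power2_eq_square algebra_simps)
    also have "\<dots> = 0" unfolding 1 2 by (simp add: algebra_simps)
    finally have "t\<^sup>2 = t'\<^sup>2 \<or> x = 0" by (simp flip: of_real_power)
    moreover have "t\<^sup>2 \<noteq> t'\<^sup>2"
      using uv[OF that(1)] uv[OF that(2)] that(3) by (simp add: power2_eq_iff)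
    ultimately show ?thesis by (simp add: x_def)
  qed
  have "inj_on u ?C"
  proof (rule inj_onI, rule ccontr)
    fix t t' assume t: "t \<in> ?C" "t' \<in> ?C" "u t = u t'" "t \<noteq> t'"
    then have "(norm (u t))\<^sup>2 = 0" using orth[OF t(1,2,4)] cinner_self[of "u t"] by simp
    with uv[OF t(1)] show False by simp
  qed
  moreover have "finite (u ` ?C)"
    by (rule pairwise_orthogonal_imp_finite)
      (auto simp: pairwise_def orthogonal_def simp flip: Re_cinner, metis orth zero_complex.sel(1))
  ultimately show ?thesis by (rule finite_imageD[rotated])
qed

lemma schmidt_coeff_sq_le:
  assumes "overlap_bound \<Phi> c" "t \<in> schmidt_coeffs \<Phi>"
  shows "t\<^sup>2 \<le> c"
proof -
  obtain u v where t: "t > 0" "norm u = 1" "norm v = 1" "contr_right v \<Phi> = t *\<^sub>R u"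
    using assms(2) by (rule schmidt_coeffsE)
  with contr_right_norm_le[OF assms(1), of v] show ?thesis by simp
qed

text \<open>Every coefficient is the norm of a contraction with a unit vector, hence obeys any
  overlap bound; conversely the decomposition started at a maximiser attains the best one.
  Finiteness of the set of coefficients gives \<open>Max\<close> its meaning.\<close>

lemma lambda_max_le_iff:
  assumes "\<Phi> \<noteq> 0"
  shows "lambda_max \<Phi> \<le> c \<longleftrightarrow> overlap_bound \<Phi> c"
proof -
  obtain r s e f where d: "schmidt_decomposition \<Phi> r s e f" "r > 0" "overlap_bound \<Phi> ((s 0)\<^sup>2)"
    using schmidt_exists_max[OF assms] .
  have ne: "s 0 \<in> schmidt_coeffs \<Phi>"
    using d unfolding schmidt_coeffs_def by blast
  have fin: "finite ((\<lambda>s. s\<^sup>2) ` schmidt_coeffs \<Phi>)"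
    by (simp add: finite_schmidt_coeffs)
  have "lambda_max \<Phi> \<le> c \<longleftrightarrow> (\<forall>t\<in>schmidt_coeffs \<Phi>. t\<^sup>2 \<le> c)"
    unfolding lambda_max_def using ne by (subst Max_le_iff[OF fin]) auto
  also have "\<dots> \<longleftrightarrow> overlap_bound \<Phi> c"
  proof
    assume "\<forall>t\<in>schmidt_coeffs \<Phi>. t\<^sup>2 \<le> c"
    with ne have "(s 0)\<^sup>2 \<le> c" by blast
    with d(3) show "overlap_bound \<Phi> c"
      unfolding overlap_bound_def
      by (meson mult_right_mono order_trans zero_le_power2)
  next
    assume "overlap_bound \<Phi> c"
    then show "\<forall>t\<in>schmidt_coeffs \<Phi>. t\<^sup>2 \<le> c"
      using schmidt_coeff_sq_le by blast
  qed
  finally show ?thesis .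
qed

lemma lambda_max_nonneg:
  assumes "\<Phi> \<noteq> 0" shows "0 \<le> lambda_max \<Phi>"
proof -
  have "overlap_bound \<Phi> (lambda_max \<Phi>)" using lambda_max_le_iff[OF assms] by blast
  from contr_right_norm_le[OF this, of "ket undefined"] show ?thesis
    by simp (meson order_trans zero_le_power2)
qed

subsection \<open>Monotonicity under LOCC\<close>

lemma op_tensor_left_component:
  "((E \<otimes>\<^sub>m mat 1) *v \<Phi>) $ (i, j) = (\<Sum>k\<in>UNIV. E $ i $ k * \<Phi> $ (k, j))"
  by (simp add: matrix_vector_mult_def op_tensor_def sum_UNIV_prod mat_def if_distrib[of "\<lambda>x. c * x" for c]
      if_distrib[of "\<lambda>x. x * c" for c] cong: if_cong)

lemma op_tensor_right_component:
  "((mat 1 \<otimes>\<^sub>m F) *v \<Phi>) $ (i, j) = (\<Sum>l\<in>UNIV. F $ j $ l * \<Phi> $ (i, l))"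
  by (simp add: matrix_vector_mult_def op_tensor_def sum_UNIV_prod mat_def if_distrib[of "\<lambda>x. c * x" for c]
      if_distrib[of "\<lambda>x. x * c" for c] cong: if_cong)
    (subst sum.swap, simp)

text \<open>Alice's operator commutes with a bra on Bob's side, so her instrument acts on the
  contracted vector as an ordinary local instrument.\<close>

lemma contr_right_op_left: "contr_right v ((E \<otimes>\<^sub>m mat 1) *v \<Phi>) = E *v contr_right v \<Phi>"
proof -
  have "contr_right v ((E \<otimes>\<^sub>m mat 1) *v \<Phi>) $ i = (E *v contr_right v \<Phi>) $ i" for i
    by (simp add: contr_right_def op_tensor_left_component)
      (simp add: matrix_vector_mult_def sum_distrib_left mult_ac, rule sum.swap)
  then show ?thesis by (simp add: vec_eq_iff)
qed

lemma contr_left_op_right: "contr_left u ((mat 1 \<otimes>\<^sub>m F) *v \<Phi>) = F *v contr_left u \<Phi>"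
proof -
  have "contr_left u ((mat 1 \<otimes>\<^sub>m F) *v \<Phi>) $ i = (F *v contr_left u \<Phi>) $ i" for i
    by (simp add: contr_left_def op_tensor_right_component)
      (simp add: matrix_vector_mult_def sum_distrib_left mult_ac, rule sum.swap)
  then show ?thesis by (simp add: vec_eq_iff)
qed

lemma op_tensor_left_tensor: "(E \<otimes>\<^sub>m mat 1) *v (u \<otimes> v) = (E *v u) \<otimes> v"
proof -
  have "((E \<otimes>\<^sub>m mat 1) *v (u \<otimes> v)) $ (i, j) = ((E *v u) \<otimes> v) $ (i, j)" for i j
    unfolding op_tensor_left_component
    by (simp add: ket_tensor_def matrix_vector_mult_def sum_distrib_left mult_ac)
  then show ?thesis by (simp add: vec_eq_iff)
qed

lemma op_tensor_right_tensor: "(mat 1 \<otimes>\<^sub>m F) *v (u \<otimes> v) = u \<otimes> (F *v v)"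
proof -
  have "((mat 1 \<otimes>\<^sub>m F) *v (u \<otimes> v)) $ (i, j) = (u \<otimes> (F *v v)) $ (i, j)" for i j
    unfolding op_tensor_right_component
    by (simp add: ket_tensor_def matrix_vector_mult_def sum_distrib_left mult_ac)
  then show ?thesis by (simp add: vec_eq_iff)
qed

text \<open>With Bob's vector \<open>v\<close> contracted first, completeness splits the squared
  norm of the remaining local vector over the outcomes, and each term is a contraction of a branch
  state. No bound on the vector \<open>u\<close> enters beyond Cauchy-Schwarz.\<close>

lemma overlap_bound_alice:
  assumes E: "(\<Sum>i<(r::nat). adj (E i) ** E i) = mat 1"
    and bd: "\<And>i. i < r \<Longrightarrow> overlap_bound ((E i \<otimes>\<^sub>m mat 1) *v \<Phi>) (c i)"
  shows "overlap_bound \<Phi> (\<Sum>i<r. c i)"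
  unfolding overlap_bound_def
proof (intro allI)
  fix u v
  let ?w = "contr_right v \<Phi>"
  have "(norm (cinner (u \<otimes> v) \<Phi>))\<^sup>2 \<le> (norm u * norm ?w)\<^sup>2"
    unfolding cinner_tensor_right by (intro power_mono cinner_Cauchy_Schwarz) simp
  also have "(norm u * norm ?w)\<^sup>2 = (norm u)\<^sup>2 * (\<Sum>i<r. (norm (E i *v ?w))\<^sup>2)"
    by (simp add: power_mult_distrib sum_norm_kraus[OF E])
  also have "\<dots> \<le> (norm u)\<^sup>2 * (\<Sum>i<r. c i * (norm v)\<^sup>2)"
    using contr_right_norm_le[OF bd]
    by (intro mult_left_mono sum_mono) (simp_all add: contr_right_op_left)
  finally show "(norm (cinner (u \<otimes> v) \<Phi>))\<^sup>2 \<le> sum c {..<r} * (norm u)\<^sup>2 * (norm v)\<^sup>2"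
    by (simp add: sum_distrib_left sum_distrib_right mult_ac)
qed

lemma overlap_bound_bob:
  assumes F: "(\<Sum>i<(r::nat). adj (F i) ** F i) = mat 1"
    and bd: "\<And>i. i < r \<Longrightarrow> overlap_bound ((mat 1 \<otimes>\<^sub>m F i) *v \<Phi>) (c i)"
  shows "overlap_bound \<Phi> (\<Sum>i<r. c i)"
  unfolding overlap_bound_def
proof (intro allI)
  fix u v
  let ?w = "contr_left u \<Phi>"
  have "(norm (cinner (u \<otimes> v) \<Phi>))\<^sup>2 \<le> (norm v * norm ?w)\<^sup>2"
    unfolding cinner_tensor_left by (intro power_mono cinner_Cauchy_Schwarz) simp
  also have "(norm v * norm ?w)\<^sup>2 = (norm v)\<^sup>2 * (\<Sum>i<r. (norm (F i *v ?w))\<^sup>2)"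
    by (simp add: power_mult_distrib sum_norm_kraus[OF F])
  also have "\<dots> \<le> (norm v)\<^sup>2 * (\<Sum>i<r. c i * (norm u)\<^sup>2)"
    using contr_left_norm_le[OF bd]
    by (intro mult_left_mono sum_mono) (simp_all add: contr_left_op_right)
  finally show "(norm (cinner (u \<otimes> v) \<Phi>))\<^sup>2 \<le> sum c {..<r} * (norm u)\<^sup>2 * (norm v)\<^sup>2"
    by (simp add: sum_distrib_left sum_distrib_right mult_ac)
qed

section \<open>Defect from the Bell pair and protocols with zero defect\<close>

definition trace_re :: "complex ^ 'n ^ 'n \<Rightarrow> real" where
  "trace_re \<rho> = Re (\<Sum>i\<in>UNIV. \<rho> $ i $ i)"

text \<open>Twice the weight of a state of \<open>A B\<close> on the orthogonal complement of the Bell pair.\<close>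

definition bell_defect :: "complex ^ (2 \<times> 2) ^ (2 \<times> 2) \<Rightarrow> real" where
  "bell_defect \<rho> = Re (2 * \<rho> $ (0, 1) $ (0, 1) + 2 * \<rho> $ (1, 0) $ (1, 0) + \<rho> $ (0, 0) $ (0, 0)
     + \<rho> $ (1, 1) $ (1, 1) - \<rho> $ (0, 0) $ (1, 1) - \<rho> $ (1, 1) $ (0, 0))"

lemma reduced_AB_sum: "reduced_AB (sum \<rho> S) = (\<Sum>i\<in>S. reduced_AB (\<rho> i))"
proof -
  have "reduced_AB (\<rho> + \<sigma>) = reduced_AB \<rho> + reduced_AB \<sigma>" for \<rho> \<sigma> :: "complex ^ ((2 \<times> 'a) \<times> (2 \<times> 'b)) ^ ((2 \<times> 'a) \<times> (2 \<times> 'b))"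
    by (simp add: reduced_AB_def vec_eq_iff sum.distrib)
  moreover have "reduced_AB 0 = (0 :: complex ^ (2 \<times> 2) ^ (2 \<times> 2))"
    by (simp add: reduced_AB_def vec_eq_iff)
  ultimately show ?thesis
    by (induction S rule: infinite_finite_induct) auto
qed

lemma bell_defect_sum: "bell_defect (sum \<rho> S) = (\<Sum>i\<in>S. bell_defect (\<rho> i))"
  by (simp add: bell_defect_def sum.distrib sum_subtractf sum_distrib_left)

lemma trace_re_sum: "trace_re (sum \<rho> S) = (\<Sum>i\<in>S. trace_re (\<rho> i))"
proof -
  have "(\<Sum>i\<in>UNIV. \<Sum>j\<in>S. \<rho> j $ i $ i) = (\<Sum>j\<in>S. \<Sum>i\<in>UNIV. \<rho> j $ i $ i)" by (rule sum.swap)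
  then show ?thesis by (simp add: trace_re_def)
qed

lemma UNIV_bit: "(UNIV :: 2 set) = {0, 1}"
  using exhaust_2 by (auto simp: UNIV_2)

lemma sum_bit: "(\<Sum>a\<in>(UNIV :: 2 set). f a) = f 0 + f 1"
  by (simp add: UNIV_bit)

lemma all_bit: "(\<forall>a::2. P a) \<longleftrightarrow> P 0 \<and> P 1"
  using UNIV_bit by (metis UNIV_I insertE singletonD)

lemma mult_cnj_self: "z * cnj z = of_real ((cmod z)\<^sup>2)"
  using complex_norm_square[of z] by simp

text \<open>For each value of the leftover indices the four diagonal-block terms complete a square.
  As a sum of squares the defect is nonnegative on pure states, and its vanishing determines the
  amplitudes.\<close>

lemma bell_defect_proj:
  "bell_defect (reduced_AB (proj \<eta>)) = (\<Sum>l\<in>UNIV. \<Sum>r\<in>UNIV.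
     2 * (cmod (\<eta> $ ((0, l), (1, r))))\<^sup>2 + 2 * (cmod (\<eta> $ ((1, l), (0, r))))\<^sup>2
     + (cmod (\<eta> $ ((0, l), (0, r)) - \<eta> $ ((1, l), (1, r))))\<^sup>2)"
proof -
  have *: "(cmod (x - y))\<^sup>2 = Re (x * cnj x + y * cnj y - x * cnj y - y * cnj x)" for x y
    using arg_cong[OF mult_cnj_self[of "x - y"], of Re] by (simp add: algebra_simps)
  show ?thesis
    by (simp add: bell_defect_def reduced_AB_def proj_def * mult_cnj_self sum_distrib_left
        flip: sum.distrib sum_subtractf) (simp add: algebra_simps)
qed

lemma trace_re_proj: "trace_re (proj \<eta>) = (norm \<eta>)\<^sup>2"
  by (simp add: trace_re_def proj_def mult_cnj_self norm_sq_vec)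

lemma trace_re_reduced_AB: "trace_re (reduced_AB \<rho>) = trace_re \<rho>"
proof -
  have "(\<Sum>a\<in>UNIV. \<Sum>b\<in>UNIV. \<Sum>l\<in>UNIV. \<Sum>r\<in>UNIV. \<rho> $ ((a, l), (b, r)) $ ((a, l), (b, r)))
    = (\<Sum>a\<in>UNIV. \<Sum>l\<in>UNIV. \<Sum>b\<in>UNIV. \<Sum>r\<in>UNIV. \<rho> $ ((a, l), (b, r)) $ ((a, l), (b, r)))"
    by (intro sum.cong refl sum.swap)
  then show ?thesis by (simp add: trace_re_def reduced_AB_def sum_UNIV_prod)
qed

lemma bell_defect_proj_nonneg: "0 \<le> bell_defect (reduced_AB (proj \<eta>))"
  unfolding bell_defect_proj by (intro sum_nonneg) simp

text \<open>No defect means \<open>\<eta> = \<Sum>\<^sub>a |a a\<rangle> \<otimes> \<omega>\<close>, and then each overlap is at most the norm of \<open>\<omega>\<close>.\<close>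

lemma bell_defect_zero_overlap:
  assumes "bell_defect (reduced_AB (proj \<eta>)) = 0"
  shows "overlap_bound \<eta> ((norm \<eta>)\<^sup>2 / 2)"
proof -
  have z: "2 * (cmod (\<eta> $ ((0, l), (1, r))))\<^sup>2 + 2 * (cmod (\<eta> $ ((1, l), (0, r))))\<^sup>2
     + (cmod (\<eta> $ ((0, l), (0, r)) - \<eta> $ ((1, l), (1, r))))\<^sup>2 = 0" for l r
  proof -
    have "(\<Sum>l\<in>UNIV. \<Sum>r\<in>UNIV.
     2 * (cmod (\<eta> $ ((0, l), (1, r))))\<^sup>2 + 2 * (cmod (\<eta> $ ((1, l), (0, r))))\<^sup>2
     + (cmod (\<eta> $ ((0, l), (0, r)) - \<eta> $ ((1, l), (1, r))))\<^sup>2) = 0" (is "(\<Sum>l\<in>UNIV. \<Sum>r\<in>UNIV. ?g l r) = 0")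
      using assms by (simp only: bell_defect_proj)
    then have "(\<Sum>r\<in>UNIV. ?g l r) = 0"
      by (subst (asm) sum_nonneg_eq_0_iff) (auto intro!: sum_nonneg)
    then show "?g l r = 0"
      by (subst (asm) sum_nonneg_eq_0_iff) auto
  qed
  define \<omega> where "\<omega> = (\<chi> p. \<eta> $ ((0, fst p), (0, snd p)))"
  have \<eta>: "\<eta> $ ((a, l), (b, r)) = (if a = b then \<omega> $ (l, r) else 0)" for a b l r
  proof -
    have "\<forall>a b. \<eta> $ ((a, l), (b, r)) = (if a = b then \<omega> $ (l, r) else 0)"
      using z[of l r] by (simp add: all_bit \<omega>_def add_nonneg_eq_0_iff)
    then show ?thesis by blast
  qed
  \<comment> \<open>Two equal blocks share the norm of \<eta>; this is the source of the constant
    1/2.\<close>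
  have n\<eta>: "(norm \<eta>)\<^sup>2 = 2 * (norm \<omega>)\<^sup>2"
    by (simp add: norm_sq_vec sum_UNIV_prod sum_bit \<eta>)
  have n\<omega>: "(norm \<omega>)\<^sup>2 = (\<Sum>l\<in>UNIV. (norm (\<chi> r. \<omega> $ (l, r)))\<^sup>2)"
    by (simp add: norm_sq_vec sum_UNIV_prod)
  have nv: "(norm v)\<^sup>2 = (\<Sum>a\<in>UNIV. (norm (\<chi> r. v $ (a, r)))\<^sup>2)" for v :: "complex ^ (2 \<times> 'b)"
    by (simp add: norm_sq_vec sum_UNIV_prod)
  \<comment> \<open>Block by block, the contraction consists of inner products of the blocks of
    \<open>v\<close> with the rows of \<omega>. Cauchy-Schwarz on each entry gives the
    Hilbert-Schmidt bound.\<close>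
  have contr: "(norm (contr_right v \<eta>))\<^sup>2 \<le> (norm \<omega>)\<^sup>2 * (norm v)\<^sup>2" for v
  proof -
    have "contr_right v \<eta> $ (a, l) = cinner (\<chi> r. v $ (a, r)) (\<chi> r. \<omega> $ (l, r))" for a l
    proof -
      have "\<forall>a. contr_right v \<eta> $ (a, l) = cinner (\<chi> r. v $ (a, r)) (\<chi> r. \<omega> $ (l, r))"
        by (simp add: all_bit contr_right_def sum_UNIV_prod sum_bit \<eta> cinner_def)
      then show ?thesis by blast
    qed
    then have "(norm (contr_right v \<eta>))\<^sup>2
        = (\<Sum>a\<in>UNIV. \<Sum>l\<in>UNIV. (norm (cinner (\<chi> r. v $ (a, r)) (\<chi> r. \<omega> $ (l, r))))\<^sup>2)"
      by (simp add: norm_sq_vec sum_UNIV_prod)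
    also have "\<dots> \<le> (\<Sum>a\<in>UNIV. \<Sum>l\<in>UNIV. (norm (\<chi> r. v $ (a, r)) * norm (\<chi> r. \<omega> $ (l, r)))\<^sup>2)"
      by (intro sum_mono power_mono cinner_Cauchy_Schwarz) simp
    also have "\<dots> = (norm \<omega>)\<^sup>2 * (norm v)\<^sup>2"
      unfolding n\<omega> nv sum_product power_mult_distrib by (subst sum.swap) (simp add: mult.commute)
    finally show ?thesis .
  qed
  show ?thesis
    unfolding overlap_bound_def
  proof (intro allI)
    fix u v
    have "(norm (cinner (u \<otimes> v) \<eta>))\<^sup>2 \<le> (norm u * norm (contr_right v \<eta>))\<^sup>2"
      unfolding cinner_tensor_right by (intro power_mono cinner_Cauchy_Schwarz) simp
    also have "\<dots> \<le> (norm u)\<^sup>2 * ((norm \<omega>)\<^sup>2 * (norm v)\<^sup>2)"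
      unfolding power_mult_distrib by (intro mult_left_mono contr) simp
    finally show "(norm (cinner (u \<otimes> v) \<eta>))\<^sup>2 \<le> (norm \<eta>)\<^sup>2 / 2 * (norm u)\<^sup>2 * (norm v)\<^sup>2"
      by (simp add: n\<eta> mult_ac)
  qed
qed

text \<open>Unrolling the protocol writes the output as a sum of projections, one per leaf. The
  state is arbitrary in the induction because each round replaces it by an unnormalised
  branch.\<close>

lemma locc_defect_nonneg: "locc \<Lambda> \<Longrightarrow> 0 \<le> bell_defect (reduced_AB (\<Lambda> (proj \<Phi>)))"
  by (induction arbitrary: \<Phi> rule: locc.induct)
    (auto simp: bell_defect_proj_nonneg proj_conj reduced_AB_sum bell_defect_sum intro!: sum_nonneg)

text \<open>A vanishing sum of nonnegative defects vanishes in each branch, so the induction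
  hypothesis applies to every branch. The trace stands in place of 1 because branch states are
  unnormalised and both traces and overlap bounds add up over outcomes.\<close>

lemma locc_overlap_bound:
  assumes "locc \<Lambda>" "bell_defect (reduced_AB (\<Lambda> (proj \<Phi>))) = 0"
  shows "overlap_bound \<Phi> (trace_re (reduced_AB (\<Lambda> (proj \<Phi>))) / 2)"
  using assms
proof (induction arbitrary: \<Phi> rule: locc.induct)
  case stop
  then show ?case
    using bell_defect_zero_overlap[of \<Phi>] by (simp add: trace_re_reduced_AB trace_re_proj)
next
  case (alice E r \<Lambda>)
  let ?R = "\<lambda>i. reduced_AB (\<Lambda> i (proj ((E i \<otimes>\<^sub>m mat 1) *v \<Phi>)))"
  have "(\<Sum>i<r. bell_defect (?R i)) = 0"
    using alice.prems by (simp add: proj_conj reduced_AB_sum bell_defect_sum)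
  then have "bell_defect (?R i) = 0" if "i < r" for i
    using that alice(2) locc_defect_nonneg by (subst (asm) sum_nonneg_eq_0_iff) auto
  then have "overlap_bound ((E i \<otimes>\<^sub>m mat 1) *v \<Phi>) (trace_re (?R i) / 2)" if "i < r" for i
    using that alice by auto
  from overlap_bound_alice[OF alice(1) this] show ?case
    by (simp add: proj_conj reduced_AB_sum trace_re_sum sum_divide_distrib)
next
  case (bob F r \<Lambda>)
  let ?R = "\<lambda>i. reduced_AB (\<Lambda> i (proj ((mat 1 \<otimes>\<^sub>m F i) *v \<Phi>)))"
  have "(\<Sum>i<r. bell_defect (?R i)) = 0"
    using bob.prems by (simp add: proj_conj reduced_AB_sum bell_defect_sum)
  then have "bell_defect (?R i) = 0" if "i < r" for i
    using that bob(2) locc_defect_nonneg by (subst (asm) sum_nonneg_eq_0_iff) auto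
  then have "overlap_bound ((mat 1 \<otimes>\<^sub>m F i) *v \<Phi>) (trace_re (?R i) / 2)" if "i < r" for i
    using that bob by auto
  from overlap_bound_bob[OF bob(1) this] show ?case
    by (simp add: proj_conj reduced_AB_sum trace_re_sum sum_divide_distrib)
qed

lemma bell_component:
  "bell $ (a, b) = (if a = b then of_real (1 / sqrt 2) else 0)"
proof -
  have "\<forall>a b. bell $ (a, b) = (if a = b then of_real (1 / sqrt 2) else 0)"
    by (simp add: bell_def ket_tensor_def ket_def axis_def all_bit scaleR_conv_of_real[where 'a = complex])
  then show ?thesis by blast
qed

lemma proj_bell:
  "proj bell $ (a, b) $ (c, d) = (if a = b \<and> c = d then 1 / 2 else 0)"
proof -
  have "complex_of_real (1 / sqrt 2) * of_real (1 / sqrt 2) = 1 / 2"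
    by (simp flip: of_real_mult)
  then show ?thesis by (simp add: proj_def bell_component)
qed

lemma locc_bell_overlap_bound:
  assumes "locc \<Lambda>" "reduced_AB (\<Lambda> (proj \<Phi>)) = proj bell"
  shows "overlap_bound \<Phi> (1 / 2)"
proof -
  have "bell_defect (proj bell) = 0" by (simp add: bell_defect_def proj_bell)
  moreover have "trace_re (proj bell) = 1"
    by (simp add: trace_re_def sum_UNIV_prod sum_bit proj_bell)
  ultimately show ?thesis using locc_overlap_bound[OF assms(1), of \<Phi>] assms(2) by simp
qed

subsection \<open>Ancillas\<close>

definition append_ket :: "complex ^ 'x::finite \<Rightarrow> complex ^ (2 \<times> 'a::finite) \<Rightarrow> complex ^ (2 \<times> 'a \<times> 'x)" where
  "append_ket \<alpha> u = (\<chi> i. u $ (fst i, fst (snd i)) * \<alpha> $ snd (snd i))"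

lemma cinner_append_ket: "cinner (append_ket \<alpha> u) (append_ket \<alpha>' u') = cinner u u' * cinner \<alpha> \<alpha>'"
  by (simp add: cinner_def append_ket_def sum_UNIV_prod sum_product sum_distrib_left
      sum_distrib_right mult_ac)

lemma with_ancillas_tensor:
  "with_ancillas \<alpha> \<beta> (u \<otimes> v) = append_ket \<alpha> u \<otimes> append_ket \<beta> v"
  by (simp add: with_ancillas_def append_ket_def ket_tensor_def vec_eq_iff mult_ac)

lemma with_ancillas_add:
  "with_ancillas \<alpha> \<beta> (\<Phi> + \<Psi>) = with_ancillas \<alpha> \<beta> \<Phi> + with_ancillas \<alpha> \<beta> \<Psi>"
  by (simp add: with_ancillas_def vec_eq_iff algebra_simps)

lemma with_ancillas_zero: "with_ancillas \<alpha> \<beta> 0 = 0"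
  by (simp add: with_ancillas_def vec_eq_iff)

lemma with_ancillas_sum: "with_ancillas \<alpha> \<beta> (sum \<Phi> S) = (\<Sum>i\<in>S. with_ancillas \<alpha> \<beta> (\<Phi> i))"
  by (induction S rule: infinite_finite_induct) (auto simp: with_ancillas_add with_ancillas_zero)

lemma with_ancillas_scaleR: "with_ancillas \<alpha> \<beta> (c *\<^sub>R \<Phi>) = c *\<^sub>R with_ancillas \<alpha> \<beta> \<Phi>"
  by (simp add: with_ancillas_def vec_eq_iff)

lemma cinner_append_with_ancillas:
  "cinner (append_ket \<alpha> u \<otimes> append_ket \<beta> v) (with_ancillas \<alpha> \<beta> \<Phi>)
     = cinner (u \<otimes> v) \<Phi> * (cinner \<alpha> \<alpha> * cinner \<beta> \<beta>)"
proof -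
  have "contr_right (append_ket \<beta> v) (with_ancillas \<alpha> \<beta> \<Phi>)
      = cinner \<beta> \<beta> *s append_ket \<alpha> (contr_right v \<Phi>)"
    by (simp add: vec_eq_iff contr_right_def append_ket_def with_ancillas_def cinner_def
        sum_UNIV_prod sum_product sum_distrib_left sum_distrib_right mult_ac)
  then show ?thesis
    by (simp add: cinner_tensor_right cinner_scale_right cinner_append_ket)
qed

lemma append_ket_norm:
  assumes "norm \<alpha> = 1"
  shows "norm (append_ket \<alpha> u) = norm u"
proof -
  have "complex_of_real ((norm (append_ket \<alpha> u))\<^sup>2) = of_real ((norm u)\<^sup>2)"
    using assms by (simp only: cinner_self[symmetric] cinner_append_ket) (simp add: cinner_self)
  then have "(norm (append_ket \<alpha> u))\<^sup>2 = (norm u)\<^sup>2" by (simp only: of_real_eq_iff)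
  then show ?thesis by (simp add: power2_eq_iff_nonneg)
qed

text \<open>Restricting the test vectors to those with the ancillas appended recovers exactly the
  overlaps of \<Phi>.\<close>

lemma overlap_bound_with_ancillas:
  assumes "norm \<alpha> = 1" "norm \<beta> = 1" "overlap_bound (with_ancillas \<alpha> \<beta> \<Phi>) c"
  shows "overlap_bound \<Phi> c"
  unfolding overlap_bound_def
proof (intro allI)
  fix u v
  show "(norm (cinner (u \<otimes> v) \<Phi>))\<^sup>2 \<le> c * (norm u)\<^sup>2 * (norm v)\<^sup>2"
    using assms(3)[unfolded overlap_bound_def, rule_format, of "append_ket \<alpha> u" "append_ket \<beta> v"]
    by (simp add: append_ket_norm assms cinner_append_with_ancillas cinner_self)
qed

lemma schmidt_decomposition_with_ancillas:
  assumes "norm \<alpha> = 1" "norm \<beta> = 1" "schmidt_decomposition \<Phi> r s e f"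
  shows "schmidt_decomposition (with_ancillas \<alpha> \<beta> \<Phi>) r s (\<lambda>i. append_ket \<alpha> (e i)) (\<lambda>i. append_ket \<beta> (f i))"
  using assms
  by (auto simp: schmidt_decomposition_def orthonormal_fam_def cinner_append_ket cinner_self
      with_ancillas_sum with_ancillas_scaleR with_ancillas_tensor)

subsection \<open>Nielsen's protocol\<close>

text \<open>
  Lay intervals of lengths \<open>p i\<close> end to end on a circle of circumference 1 and let \<open>w i j\<close> be the
  measure of the points of the first half circle that lie in interval \<open>i\<close> and whose antipode lies in
  interval \<open>j\<close>. No interval is longer than half the circle, so it does not meet its own antipode.
\<close>

lemma antipodal_weights:
  fixes p :: "nat \<Rightarrow> real"
  assumes p: "\<And>i. i < r \<Longrightarrow> 0 \<le> p i" "\<And>i. i < r \<Longrightarrow> p i \<le> 1 / 2" and sum1: "(\<Sum>i<r. p i) = 1"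
  obtains w :: "nat \<Rightarrow> nat \<Rightarrow> real" where
    "\<And>i j. i < r \<Longrightarrow> j < r \<Longrightarrow> 0 \<le> w i j" "\<And>i. i < r \<Longrightarrow> w i i = 0"
    "\<And>i. i < r \<Longrightarrow> (\<Sum>j<r. w i j) + (\<Sum>j<r. w j i) = p i"
proof -
  \<comment> \<open>\<open>P\<close> lists the interval endpoints. Interval \<open>i\<close> meets
    the first half circle in \<open>[Q i, Q (Suc i)]\<close>; the part of interval \<open>j\<close>
    in the second half, moved back by 1/2, is \<open>[R j, R (Suc j)]\<close>. The difference of
    clamps in \<open>w\<close> is the length of their intersection.\<close>
  define P where "P k = (\<Sum>i<k. p i)" for k
  define Q where "Q k = min (P k) (1 / 2)" for k
  define R where "R k = max (P k) (1 / 2) - 1 / 2" for k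
  define clamp :: "real \<Rightarrow> real \<Rightarrow> real \<Rightarrow> real" where "clamp a b x = max a (min b x)" for a b x
  define w where "w i j = clamp (Q i) (Q (Suc i)) (R (Suc j)) - clamp (Q i) (Q (Suc i)) (R j)" for i j
  have PS: "P (Suc i) = P i + p i" for i by (simp add: P_def)
  have P0: "P 0 = 0" and Pr: "P r = 1" by (simp_all add: P_def sum1)
  have P_le: "P i \<le> P (Suc i)" "P (Suc i) \<le> P i + 1 / 2" if "i < r" for i
    using p[OF that] by (simp_all add: PS)
  have P_bds: "0 \<le> P i" "P i \<le> 1" if "i \<le> r" for i
  proof -
    show "0 \<le> P i" using that p by (auto simp: P_def intro!: sum_nonneg)
    have "P i \<le> P r" using that p by (auto simp: P_def intro!: sum_mono2)
    then show "P i \<le> 1" by (simp add: Pr)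
  qed
  have Q_le: "Q i \<le> Q (Suc i)" and R_le: "R i \<le> R (Suc i)" if "i < r" for i
    using P_le[OF that] by (auto simp: Q_def R_def)
  have Q_bds: "0 \<le> Q i" "Q i \<le> 1 / 2" and R_bds: "0 \<le> R i" "R i \<le> 1 / 2" if "i \<le> r" for i
    using P_bds[OF that] by (auto simp: Q_def R_def)
  have Qr: "Q r = 1 / 2" and Q0: "Q 0 = 0" and Rr: "R r = 1 / 2" and R0: "R 0 = 0"
    by (simp_all add: Q_def R_def P0 Pr)
  \<comment> \<open>Intersection length is symmetric in the two intervals. This form of
    \<open>w\<close> telescopes in its first index, the defining form in its second.\<close>
  have clamp_swap: "clamp a b d - clamp a b c = clamp c d b - clamp c d a" if "a \<le> b" "c \<le> d" for a b c d
    using that by (auto simp: clamp_def max_def min_def)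
  have w': "w i j = clamp (R j) (R (Suc j)) (Q (Suc i)) - clamp (R j) (R (Suc j)) (Q i)"
    if "i < r" "j < r" for i j
    unfolding w_def using that by (intro clamp_swap Q_le R_le)
  have row: "(\<Sum>j<r. w i j) = Q (Suc i) - Q i" if "i < r" for i
    using that Q_bds[of i] Q_bds[of "Suc i"] Q_le[of i]
      sum_lessThan_telescope[of "\<lambda>j. clamp (Q i) (Q (Suc i)) (R j)" r]
    by (simp add: w_def Rr R0) (simp add: clamp_def)
  have "(\<Sum>j<r. w j i) = (\<Sum>j<r. clamp (R i) (R (Suc i)) (Q (Suc j)) - clamp (R i) (R (Suc i)) (Q j))"
    if "i < r" for i
    using that by (intro sum.cong) (simp_all add: w')
  then have col: "(\<Sum>j<r. w j i) = R (Suc i) - R i" if "i < r" for i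
    using that R_bds[of i] R_bds[of "Suc i"] R_le[of i]
      sum_lessThan_telescope[of "\<lambda>j. clamp (R i) (R (Suc i)) (Q j)" r]
    by (simp add: Qr Q0) (simp add: clamp_def)
  have "0 \<le> w i j" if "i < r" "j < r" for i j
    using R_le[OF that(2)] by (auto simp: w_def clamp_def)
  \<comment> \<open>Both pieces are nontrivial only if interval \<open>i\<close> contains 1/2 in its
    interior. They are then \<open>[P i, 1/2]\<close> and \<open>[0, P (Suc i) - 1/2]\<close>, and
    length at most 1/2 keeps them from overlapping.\<close>
  moreover have "w i i = 0" if "i < r" for i
    using P_le[OF that] P_bds[of i] P_bds[of "Suc i"] that
    by (auto simp: w_def clamp_def Q_def R_def max_def min_def)
  moreover have "(\<Sum>j<r. w i j) + (\<Sum>j<r. w j i) = p i" if "i < r" for i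
    using row[OF that] col[OF that] by (auto simp: Q_def R_def PS max_def min_def)
  ultimately show thesis by (rule that)
qed

section \<open>Kraus operators of the protocol\<close>

definition outer :: "complex ^ 'm \<Rightarrow> complex ^ 'n \<Rightarrow> complex ^ 'n ^ 'm" where
  "outer u v = (\<chi> i j. u $ i * cnj (v $ j))"

lemma outer_mult: "outer u v *v x = cinner v x *s u"
  by (simp add: outer_def matrix_vector_mult_def cinner_def vec_eq_iff sum_distrib_right
      sum_distrib_left mult_ac)

lemma adj_outer: "adj (outer u v) = outer v u"
  by (simp add: adj_def outer_def vec_eq_iff mult.commute)

text \<open>For orthonormal \<open>e\<close> this is the projection onto the orthogonal complement
  of their span. It completes instruments whose other operators act only on that span.\<close>

definition complement_proj :: "nat \<Rightarrow> (nat \<Rightarrow> complex ^ 'n) \<Rightarrow> complex ^ 'n ^ 'n" where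
  "complement_proj r e = mat 1 - (\<Sum>i<r. outer (e i) (e i))"

lemma complement_proj_mult: "complement_proj r e *v x = x - (\<Sum>i<r. cinner (e i) x *s e i)"
  by (simp add: complement_proj_def matrix_vector_mult_diff_rdistrib sum_matrix_vector_mult outer_mult)

lemma adj_complement_proj: "adj (complement_proj r e) = complement_proj r e"
  by (simp add: complement_proj_def adj_diff adj_sum adj_mat adj_outer)

lemma orthonormal_fam_component:
  assumes "orthonormal_fam r h" "i < r"
  shows "cinner (h i) (\<Sum>k<r. c k *s h k) = c i"
proof -
  have "cinner (h i) (\<Sum>k<r. c k *s h k) = (\<Sum>k<r. if k = i then c k else 0)"
    using assms unfolding cinner_sum_right orthonormal_fam_def
    by (intro sum.cong) (auto simp: cinner_scale_right)
  then show ?thesis using assms by simp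
qed

lemma complement_proj_idem:
  assumes "orthonormal_fam r e"
  shows "complement_proj r e *v (complement_proj r e *v x) = complement_proj r e *v x"
proof -
  have "cinner (e i) (complement_proj r e *v x) = 0" if "i < r" for i
    using orthonormal_fam_component[OF assms that, of "\<lambda>k. cinner (e k) x"]
    by (simp add: complement_proj_mult cinner_diff_right)
  then show ?thesis by (subst (1) complement_proj_mult) simp
qed

lemma complement_proj_kills:
  assumes "orthonormal_fam r e" "j < r"
  shows "complement_proj r e *v e j = 0"
proof -
  have "(\<Sum>i<r. cinner (e i) (e j) *s e i) = (\<Sum>i<r. if i = j then e i else 0)"
    using assms unfolding orthonormal_fam_def by (intro sum.cong) auto
  then show ?thesis using assms by (simp add: complement_proj_mult)
qed

lemma kraus_complete_iff:
  "(\<Sum>i\<in>S. adj (E i) ** E i) = mat 1 \<longleftrightarrow> (\<forall>x. (\<Sum>i\<in>S. adj (E i) *v (E i *v x)) = x)"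
  by (simp add: matrix_eq sum_matrix_vector_mult flip: matrix_vector_mul_assoc)

text \<open>Rule \<open>locc.alice\<close> numbers outcomes by an initial segment of the naturals,
  whereas Nielsen's outcomes are pairs plus one extra.\<close>

lemma locc_alice_finite:
  assumes "finite S" "(\<Sum>i\<in>S. adj (E i) ** E i) = mat 1" "\<And>i. i \<in> S \<Longrightarrow> locc (\<Lambda> i)"
  shows "locc (\<lambda>\<rho>. \<Sum>i\<in>S. \<Lambda> i ((E i \<otimes>\<^sub>m mat 1) ** \<rho> ** adj (E i \<otimes>\<^sub>m mat 1)))"
proof -
  obtain h where h: "bij_betw h {0..<card S} S"
    using ex_bij_betw_nat_finite[OF assms(1)] by blast
  then have h: "bij_betw h {..<card S} S" by (simp add: atLeast0LessThan)
  have "(\<Sum>i<card S. adj (E (h i)) ** E (h i)) = mat 1"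
    using sum.reindex_bij_betw[OF h, of "\<lambda>i. adj (E i) ** E i"] assms(2) by simp
  moreover have "locc (\<Lambda> (h i))" if "i < card S" for i
    using h that assms(3) by (auto simp: bij_betw_def)
  ultimately have "locc (\<lambda>\<rho>. \<Sum>i<card S. \<Lambda> (h i) ((E (h i) \<otimes>\<^sub>m mat 1) ** \<rho> ** adj (E (h i) \<otimes>\<^sub>m mat 1)))"
    by (rule locc.alice)
  moreover have "(\<Sum>i<card S. \<Lambda> (h i) ((E (h i) \<otimes>\<^sub>m mat 1) ** \<rho> ** adj (E (h i) \<otimes>\<^sub>m mat 1)))
      = (\<Sum>i\<in>S. \<Lambda> i ((E i \<otimes>\<^sub>m mat 1) ** \<rho> ** adj (E i \<otimes>\<^sub>m mat 1)))" for \<rho>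
    by (rule sum.reindex_bij_betw[OF h])
  ultimately show ?thesis by simp
qed

lemma tensor_scaleR_left: "(c *\<^sub>R u) \<otimes> v = c *\<^sub>R (u \<otimes> v)"
  by (simp add: ket_tensor_def vec_eq_iff)

lemma tensor_add_left: "(u + u') \<otimes> v = u \<otimes> v + u' \<otimes> v"
  by (simp add: ket_tensor_def vec_eq_iff algebra_simps)

lemma tensor_zero [simp]: "0 \<otimes> v = 0" "u \<otimes> 0 = 0"
  by (simp_all add: ket_tensor_def vec_eq_iff)

lemma proj_zero: "proj 0 = 0"
  by (simp add: proj_def vec_eq_iff)

lemma proj_scaleR: "proj (c *\<^sub>R v) = c\<^sup>2 *\<^sub>R proj v"
  by (simp add: proj_def vec_eq_iff power2_eq_square)

lemma reduced_AB_scaleR: "reduced_AB (c *\<^sub>R \<rho>) = c *\<^sub>R reduced_AB \<rho>"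
  by (simp add: reduced_AB_def vec_eq_iff scaleR_sum_right)

lemma matrix_vector_mult_sum: "A *v (sum f S) = (\<Sum>i\<in>S. A *v (f i :: complex ^ 'n))"
  by (induction S rule: infinite_finite_induct) (auto simp: matrix_vector_right_distrib)

text \<open>Bob's correction once he knows which two Schmidt vectors are left: a partial isometry
  \<open>U\<close> carries them to fixed kets. Its completing outcome has amplitude zero on such
  states.\<close>

lemma locc_bob_rotate:
  assumes f: "cinner f0 f0 = 1" "cinner f1 f1 = 1" "cinner f0 f1 = 0"
    and h: "cinner h0 h0 = 1" "cinner h1 h1 = 1" "cinner h0 h1 = 0"
  obtains \<Lambda> where "locc \<Lambda>"
    "\<And>c u v. \<Lambda> (proj (c *\<^sub>R (u \<otimes> f0 + v \<otimes> f1))) = proj (c *\<^sub>R (u \<otimes> h0 + v \<otimes> h1))"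
proof -
  have f10: "cinner f1 f0 = 0" "cinner h1 h0 = 0"
    using cnj_cinner[of f0 f1] cnj_cinner[of h0 h1] f h by simp_all
  let ?f = "\<lambda>k::nat. if k = 0 then f0 else f1"
  have on: "orthonormal_fam 2 ?f"
    using f f10 by (auto simp: orthonormal_fam_def less_2_cases_iff)
  define U where "U = outer h0 f0 + outer h1 f1"
  define F where "F k = (if k = 0 then U else complement_proj 2 ?f)" for k :: nat
  have U: "U *v x = cinner f0 x *s h0 + cinner f1 x *s h1"
    and adjU: "adj U *v x = cinner h0 x *s f0 + cinner h1 x *s f1" for x
    by (simp_all add: U_def matrix_vector_mult_add_rdistrib outer_mult adj_add adj_outer)
  have rest: "complement_proj 2 ?f *v x = x - (cinner f0 x *s f0 + cinner f1 x *s f1)" for x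
    by (simp add: complement_proj_mult numeral_2_eq_2)
  have complete: "(\<Sum>k<2. adj (F k) ** F k) = mat 1"
    unfolding kraus_complete_iff
    by (simp add: numeral_2_eq_2 F_def adj_complement_proj complement_proj_idem[OF on, simplified numeral_2_eq_2])
      (simp add: rest[simplified numeral_2_eq_2] U adjU cinner_linear h f10)
  define \<Lambda> where "\<Lambda> \<rho> = (\<Sum>k<(2::nat). (mat 1 \<otimes>\<^sub>m F k) ** \<rho> ** adj (mat 1 \<otimes>\<^sub>m F k))" for \<rho> :: "complex ^ ('b \<times> 'a) ^ ('b \<times> 'a)"
  have "locc \<Lambda>"
    unfolding \<Lambda>_def by (rule locc.bob[OF complete, of "\<lambda>_ \<rho>. \<rho>", OF locc.stop])
  moreover have "\<Lambda> (proj (c *\<^sub>R (u \<otimes> f0 + v \<otimes> f1))) = proj (c *\<^sub>R (u \<otimes> h0 + v \<otimes> h1))" for c u v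
  proof -
    have "U *v f0 = h0" "U *v f1 = h1" "complement_proj 2 ?f *v f0 = 0" "complement_proj 2 ?f *v f1 = 0"
      using f f10 by (simp_all add: U rest)
    then show ?thesis
      by (simp add: \<Lambda>_def numeral_2_eq_2 F_def proj_conj matrix_vector_mult_scaleR matrix_vector_right_distrib
          op_tensor_right_tensor proj_zero)
  qed
  ultimately show thesis by (rule that)
qed

text \<open>The factor 2 is the squared norm of \<open>G\<close>: a Bell pair before normalisation,
  with the leftovers in fixed kets.\<close>

lemma reduced_AB_bell_kets:
  fixes l0 :: "'l::finite" and r0 :: "'r::finite"
  defines "G \<equiv> ket (0 :: 2, l0) \<otimes> ket (0 :: 2, r0) + ket (1, l0) \<otimes> ket (1, r0)"
  shows "reduced_AB (proj G) = 2 *\<^sub>R proj bell"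
proof -
  have G: "G $ ((a, l), (b, r)) = (if l = l0 then if r = r0 then if a = b then 1 else 0 else 0 else 0)" for a b l r
  proof -
    have "\<forall>a b. G $ ((a, l), (b, r)) = (if l = l0 then if r = r0 then if a = b then 1 else 0 else 0 else 0)"
      by (auto simp: G_def ket_tensor_def ket_def axis_def all_bit)
    then show ?thesis by blast
  qed
  have "reduced_AB (proj G) $ (a, b) $ (c, d) = (2 *\<^sub>R proj bell) $ (a, b) $ (c, d)" for a b c d
  proof -
    have "reduced_AB (proj G) $ (a, b) $ (c, d)
        = (\<Sum>l\<in>UNIV. \<Sum>r\<in>UNIV. if l = l0 then if r = r0 then if a = b \<and> c = d then 1 else 0 else 0 else 0)"
      by (simp only: reduced_AB_def proj_def vec_lambda_beta fst_conv snd_conv)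
        (intro sum.cong refl, simp add: G)
    also have "\<dots> = (\<Sum>l\<in>UNIV. if l = l0 then if a = b \<and> c = d then 1 else 0 else 0)"
      by (intro sum.cong) auto
    also have "\<dots> = (2 *\<^sub>R proj bell) $ (a, b) $ (c, d)"
      by (simp add: proj_bell scaleR_conv_of_real[where 'a = complex])
    finally show ?thesis .
  qed
  then show ?thesis by (simp add: vec_eq_iff)
qed

lemma norm_sq_schmidt:
  assumes "schmidt_decomposition \<Phi> r s e f"
  shows "(norm \<Phi>)\<^sup>2 = (\<Sum>i<r. (s i)\<^sup>2)"
proof -
  have \<Phi>: "\<Phi> = (\<Sum>i<r. s i *\<^sub>R (e i \<otimes> f i))"
    using assms by (simp add: schmidt_decomposition_def)
  have "complex_of_real ((norm \<Phi>)\<^sup>2) = (\<Sum>i<r. of_real (s i) * cinner (e i \<otimes> f i) \<Phi>)"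
    unfolding cinner_self[symmetric]
    by (subst (1) \<Phi>) (simp add: cinner_sum_left cinner_scaleR_left)
  also have "\<dots> = (\<Sum>i<r. of_real ((s i)\<^sup>2))"
  proof (intro sum.cong refl)
    fix i assume "i \<in> {..<r}"
    then have "i < r" by simp
    moreover have "cinner (e i) (e i) = 1"
      using assms \<open>i < r\<close> by (simp add: schmidt_decomposition_def orthonormal_fam_def)
    ultimately show "of_real (s i) * cinner (e i \<otimes> f i) \<Phi> = complex_of_real ((s i)\<^sup>2)"
      by (simp add: cinner_tensor_right schmidt_contr[OF assms] cinner_scaleR_right power2_eq_square)
  qed
  finally show ?thesis by (simp only: of_real_sum[symmetric] of_real_eq_iff)
qed

text \<open>
  Alice's outcome \<open>(i, j)\<close> turns the pair of Schmidt components \<open>i, j\<close> into an equally weighted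
  superposition; the completing projections act on a subspace that the state does not meet.
\<close>

lemma locc_restores_bell:
  fixes \<Phi> :: "complex ^ ((2 \<times> 'l::finite) \<times> (2 \<times> 'r::finite))"
  assumes sd: "schmidt_decomposition \<Phi> r s e f" and le: "\<And>i. i < r \<Longrightarrow> (s i)\<^sup>2 \<le> 1 / 2"
    and norm: "norm \<Phi> = 1"
  obtains \<Lambda> where "locc \<Lambda>" "reduced_AB (\<Lambda> (proj \<Phi>)) = proj bell"
proof -
  obtain l0 :: 'l and r0 :: 'r where True by blast
  define g0 g1 :: "complex ^ (2 \<times> 'l)" where "g0 = ket (0, l0)" and "g1 = ket (1, l0)"
  define h0 h1 :: "complex ^ (2 \<times> 'r)" where "h0 = ket (0, r0)" and "h1 = ket (1, r0)"
  have g: "cinner g0 g0 = 1" "cinner g1 g1 = 1" "cinner g0 g1 = 0" "cinner g1 g0 = 0"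
    by (simp_all add: g0_def g1_def cinner_ket) (simp_all add: ket_def axis_def)
  have h: "cinner h0 h0 = 1" "cinner h1 h1 = 1" "cinner h0 h1 = 0"
    by (simp_all add: h0_def h1_def cinner_ket) (simp_all add: ket_def axis_def)
  have s: "s i > 0" if "i < r" for i using sd that by (simp add: schmidt_decomposition_def)
  have e: "orthonormal_fam r e" and f: "orthonormal_fam r f"
    using sd by (simp_all add: schmidt_decomposition_def)
  have sum1: "(\<Sum>i<r. (s i)\<^sup>2) = 1" using norm_sq_schmidt[OF sd] norm by simp
  obtain w :: "nat \<Rightarrow> nat \<Rightarrow> real" where
    w0: "\<And>i j. i < r \<Longrightarrow> j < r \<Longrightarrow> 0 \<le> w i j" and wd: "\<And>i. i < r \<Longrightarrow> w i i = 0"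
    and w: "\<And>i. i < r \<Longrightarrow> (\<Sum>j<r. w i j) + (\<Sum>j<r. w j i) = (s i)\<^sup>2"
    using antipodal_weights[of r "\<lambda>i. (s i)\<^sup>2"] le sum1 by auto
  define I where "I = {..<r} \<times> {..<r}"
  \<comment> \<open>Division by \<open>s i\<close> and \<open>s j\<close> cancels the Schmidt
    coefficients, so both components come out with the common amplitude
    \<open>sqrt (w i j)\<close>.\<close>
  define E where "E i j = (sqrt (w i j) / s i) *\<^sub>R outer g0 (e i) + (sqrt (w i j) / s j) *\<^sub>R outer g1 (e j)" for i j
  have E: "E i j *v x = (sqrt (w i j) / s i) *\<^sub>R (cinner (e i) x *s g0) + (sqrt (w i j) / s j) *\<^sub>R (cinner (e j) x *s g1)"
    and adjE: "adj (E i j) *v x = (sqrt (w i j) / s i) *\<^sub>R (cinner g0 x *s e i) + (sqrt (w i j) / s j) *\<^sub>R (cinner g1 x *s e j)" for i j x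
    by (simp_all add: E_def matrix_vector_mult_add_rdistrib scaleR_matrix_vector_mult outer_mult
        adj_add adj_scaleR adj_outer)
  have adjEE: "adj (E i j) *v (E i j *v x)
      = (w i j / (s i)\<^sup>2) *\<^sub>R (cinner (e i) x *s e i) + (w i j / (s j)\<^sup>2) *\<^sub>R (cinner (e j) x *s e j)"
    if "i < r" "j < r" for i j x
    using w0[OF that] unfolding adjE unfolding E
    by (simp add: cinner_linear g vec_eq_iff scaleR_conv_of_real[where 'a = complex] power2_eq_square
        field_simps flip: of_real_mult)
  \<comment> \<open>Index \<open>i\<close> collects a row sum of \<open>w\<close> from the outcomes
    where it comes first and a column sum from those where it comes second. Together they are
    \<open>(s i)\<^sup>2\<close>, so the effects add up to the projection onto the span of
    \<open>e\<close>.\<close>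
  have sum_adjEE: "(\<Sum>(i, j)\<in>I. adj (E i j) *v (E i j *v x)) = (\<Sum>i<r. cinner (e i) x *s e i)" for x
  proof -
    let ?t = "\<lambda>i. cinner (e i) x *s e i"
    have "(\<Sum>(i, j)\<in>I. adj (E i j) *v (E i j *v x))
        = (\<Sum>i<r. \<Sum>j<r. (w i j / (s i)\<^sup>2) *\<^sub>R ?t i + (w i j / (s j)\<^sup>2) *\<^sub>R ?t j)"
      unfolding I_def sum.cartesian_product[symmetric] by (intro sum.cong) (auto simp: adjEE)
    also have "\<dots> = (\<Sum>i<r. \<Sum>j<r. (w i j / (s i)\<^sup>2) *\<^sub>R ?t i) + (\<Sum>j<r. \<Sum>i<r. (w i j / (s j)\<^sup>2) *\<^sub>R ?t j)"
      unfolding sum.distrib by (intro arg_cong2[where f = "(+)"] refl sum.swap)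
    also have "\<dots> = (\<Sum>i<r. (((\<Sum>j<r. w i j) + (\<Sum>j<r. w j i)) / (s i)\<^sup>2) *\<^sub>R ?t i)"
      by (simp add: scaleR_sum_left sum_divide_distrib add_divide_distrib scaleR_left_distrib sum.distrib)
    also have "\<dots> = (\<Sum>i<r. ?t i)"
    proof (intro sum.cong refl)
      fix i assume "i \<in> {..<r}"
      then have "i < r" by simp
      then show "(((\<Sum>j<r. w i j) + (\<Sum>j<r. w j i)) / (s i)\<^sup>2) *\<^sub>R ?t i = ?t i"
        using s[of i] by (simp add: w)
    qed
    finally show ?thesis .
  qed
  \<comment> \<open>Bob's continuation must be some protocol for every index pair. A rotation exists
    only for distinct indices; diagonal outcomes have weight \<open>w i i = 0\<close>.\<close>
  have "\<forall>i j. \<exists>\<Lambda>. locc \<Lambda> \<and> (i < r \<longrightarrow> j < r \<longrightarrow> i \<noteq> j \<longrightarrow> (\<forall>c u v.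
      \<Lambda> (proj (c *\<^sub>R (u \<otimes> f i + v \<otimes> f j))) = proj (c *\<^sub>R ((u :: complex ^ (2 \<times> 'l)) \<otimes> h0 + v \<otimes> h1))))"
  proof (intro allI)
    fix i j
    show "\<exists>\<Lambda>. locc \<Lambda> \<and> (i < r \<longrightarrow> j < r \<longrightarrow> i \<noteq> j \<longrightarrow> (\<forall>c u v.
      \<Lambda> (proj (c *\<^sub>R (u \<otimes> f i + v \<otimes> f j))) = proj (c *\<^sub>R ((u :: complex ^ (2 \<times> 'l)) \<otimes> h0 + v \<otimes> h1))))"
    proof (cases "i < r \<and> j < r \<and> i \<noteq> j")
      case True
      then have "cinner (f i) (f i) = 1" "cinner (f j) (f j) = 1" "cinner (f i) (f j) = 0"
        using f by (auto simp: orthonormal_fam_def)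
      from locc_bob_rotate[OF this h] show ?thesis by metis
    qed (use locc.stop in blast)
  qed
  then obtain B where B: "\<And>i j. locc (B i j)" and
    B_rot: "\<And>i j c u v. i < r \<Longrightarrow> j < r \<Longrightarrow> i \<noteq> j \<Longrightarrow>
      B i j (proj (c *\<^sub>R (u \<otimes> f i + v \<otimes> f j))) = proj (c *\<^sub>R ((u :: complex ^ (2 \<times> 'l)) \<otimes> h0 + v \<otimes> h1))"
    by metis
  \<comment> \<open>\<open>None\<close> is the outcome of the completing projection,
    \<open>Some (i, j)\<close> that of \<open>E i j\<close>.\<close>
  define S where "S = insert None (Some ` I)"
  define K where "K o' = (case o' of None \<Rightarrow> complement_proj r e | Some (i, j) \<Rightarrow> E i j)" for o'
  define L where "L o' = (case o' of None \<Rightarrow> (\<lambda>\<rho>. \<rho>)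
    | Some (i, j) \<Rightarrow> if i = j then (\<lambda>\<rho>. \<rho>) else B i j)" for o'
  define \<Lambda> where "\<Lambda> \<rho> = (\<Sum>o'\<in>S. L o' ((K o' \<otimes>\<^sub>m mat 1) ** \<rho> ** adj (K o' \<otimes>\<^sub>m mat 1)))" for \<rho>
  have finI: "finite I" by (simp add: I_def)
  have sum_S: "sum F S = F None + (\<Sum>p\<in>I. F (Some p))" for F :: "(nat \<times> nat) option \<Rightarrow> 'z::comm_monoid_add"
    using finI by (simp add: S_def sum.reindex)
  have "(\<Sum>o'\<in>S. adj (K o') ** K o') = mat 1"
    unfolding kraus_complete_iff
  proof
    fix x
    have "(\<Sum>p\<in>I. adj (K (Some p)) *v (K (Some p) *v x)) = (\<Sum>(i, j)\<in>I. adj (E i j) *v (E i j *v x))"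
      by (intro sum.cong) (auto simp: K_def)
    then show "(\<Sum>o'\<in>S. adj (K o') *v (K o' *v x)) = x"
      unfolding sum_S sum_adjEE
      by (simp add: K_def adj_complement_proj complement_proj_idem[OF e]) (simp add: complement_proj_mult)
  qed
  then have "locc \<Lambda>"
    unfolding \<Lambda>_def using finI B locc.stop
    by (intro locc_alice_finite) (auto simp: S_def L_def split: option.splits)
  moreover have "reduced_AB (\<Lambda> (proj \<Phi>)) = proj bell"
  proof -
    have \<Phi>: "\<Phi> = (\<Sum>i<r. s i *\<^sub>R (e i \<otimes> f i))"
      using sd by (simp add: schmidt_decomposition_def)
    have "(complement_proj r e \<otimes>\<^sub>m mat 1) *v \<Phi> = 0"
      unfolding \<Phi> matrix_vector_mult_sum
      by (intro sum.neutral)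
        (simp add: matrix_vector_mult_scaleR op_tensor_left_tensor complement_proj_kills[OF e])
    then have none: "L None ((K None \<otimes>\<^sub>m mat 1) ** proj \<Phi> ** adj (K None \<otimes>\<^sub>m mat 1)) = 0"
      by (simp add: L_def K_def proj_conj proj_zero)
    have E\<Phi>: "(E i j \<otimes>\<^sub>m mat 1) *v \<Phi> = sqrt (w i j) *\<^sub>R (g0 \<otimes> f i + g1 \<otimes> f j)"
      if "i < r" "j < r" for i j
    proof -
      have "E i j *v e k = (if k = i then (sqrt (w i j) / s i) *\<^sub>R g0 else 0)
          + (if k = j then (sqrt (w i j) / s j) *\<^sub>R g1 else 0)" if "k < r" for k
        unfolding E using that \<open>i < r\<close> \<open>j < r\<close> e by (auto simp: orthonormal_fam_def)
      then have "s k *\<^sub>R ((E i j *v e k) \<otimes> f k) = (if k = i then sqrt (w i j) *\<^sub>R (g0 \<otimes> f k) else 0)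
          + (if k = j then sqrt (w i j) *\<^sub>R (g1 \<otimes> f k) else 0)" if "k < r" for k
        using that s[OF that] by (auto simp: tensor_add_left tensor_scaleR_left scaleR_add_right)
      then have "(E i j \<otimes>\<^sub>m mat 1) *v \<Phi> = (\<Sum>k<r. (if k = i then sqrt (w i j) *\<^sub>R (g0 \<otimes> f k) else 0)
          + (if k = j then sqrt (w i j) *\<^sub>R (g1 \<otimes> f k) else 0))"
        unfolding \<Phi> matrix_vector_mult_sum matrix_vector_mult_scaleR op_tensor_left_tensor
        by (intro sum.cong) auto
      then show ?thesis using that by (simp add: sum.distrib scaleR_add_right)
    qed
    have "reduced_AB (L (Some (i, j)) ((K (Some (i, j)) \<otimes>\<^sub>m mat 1) ** proj \<Phi> ** adj (K (Some (i, j)) \<otimes>\<^sub>m mat 1)))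
        = (2 * w i j) *\<^sub>R proj bell" if "(i, j) \<in> I" for i j
    proof (cases "i = j")
      case True
      then show ?thesis using that
        by (simp add: I_def L_def K_def proj_conj E\<Phi> wd proj_zero)
          (simp add: reduced_AB_def vec_eq_iff)
    next
      case False
      with that have "L (Some (i, j)) ((K (Some (i, j)) \<otimes>\<^sub>m mat 1) ** proj \<Phi> ** adj (K (Some (i, j)) \<otimes>\<^sub>m mat 1))
          = proj (sqrt (w i j) *\<^sub>R (g0 \<otimes> h0 + g1 \<otimes> h1))"
        by (simp add: I_def L_def K_def proj_conj E\<Phi> B_rot del: scaleR_add_right)
      then show ?thesis
        using w0 that
        by (simp add: I_def proj_scaleR reduced_AB_scaleR g0_def g1_def h0_def h1_def reduced_AB_bell_kets)
    qed
    then have "reduced_AB (\<Lambda> (proj \<Phi>)) = (\<Sum>(i, j)\<in>I. (2 * w i j) *\<^sub>R proj bell)"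
      unfolding \<Lambda>_def sum_S none add_0 reduced_AB_sum by (intro sum.cong) auto
    also have "\<dots> = (2 * (\<Sum>i<r. \<Sum>j<r. w i j)) *\<^sub>R proj bell"
      by (simp add: I_def sum.cartesian_product[symmetric] scaleR_sum_left sum_distrib_left)
    \<comment> \<open>The 2 from the unnormalised pair is matched by counting each weight once in a
      row and once in a column, which gives total probability 1.\<close>
    also have "2 * (\<Sum>i<r. \<Sum>j<r. w i j) = (\<Sum>i<r. (\<Sum>j<r. w i j) + (\<Sum>j<r. w j i))"
      using sum.swap[of w "{..<r}" "{..<r}"] by (simp add: sum.distrib)
    also have "\<dots> = 1" using sum1 by (simp add: w)
    finally show ?thesis by simp
  qed
  ultimately show thesis by (rule that)
qed

subsection \<open>The infimum over measurements is attained\<close>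

text \<open>The bound is scaled by the squared norm of \<Psi>, so the condition is invariant under
  rescaling \<open>M\<close> and also holds for outcomes of probability zero that leave the zero
  ket.\<close>

definition admissible ::
    "complex ^ (('m::finite \<times> 'n::finite) \<times> 'k::finite) \<Rightarrow> real \<Rightarrow> complex ^ 'k ^ 'k \<Rightarrow> bool" where
  "admissible \<Gamma> c M \<longleftrightarrow> (\<exists>\<Psi> \<kappa>. norm \<kappa> = 1 \<and> (mat 1 \<otimes>\<^sub>m M) *v \<Gamma> = \<Psi> \<otimes> \<kappa> \<and>
     overlap_bound \<Psi> (c * (norm \<Psi>)\<^sup>2))"

lemma overlap_bound_scaleR:
  assumes "overlap_bound \<Phi> c"
  shows "overlap_bound (t *\<^sub>R \<Phi>) (t\<^sup>2 * c)"
  unfolding overlap_bound_def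
proof (intro allI)
  fix u v
  have "t\<^sup>2 * (norm (cinner (u \<otimes> v) \<Phi>))\<^sup>2 \<le> t\<^sup>2 * (c * (norm u)\<^sup>2 * (norm v)\<^sup>2)"
    using assms by (intro mult_left_mono) (auto simp: overlap_bound_def)
  then show "(norm (cinner (u \<otimes> v) (t *\<^sub>R \<Phi>)))\<^sup>2 \<le> t\<^sup>2 * c * (norm u)\<^sup>2 * (norm v)\<^sup>2"
    by (simp add: cinner_scaleR_right norm_mult power_mult_distrib mult_ac)
qed

lemma op_tensor_scaleR_right: "(mat 1 \<otimes>\<^sub>m (t *\<^sub>R M)) *v \<Gamma> = t *\<^sub>R ((mat 1 \<otimes>\<^sub>m M) *v \<Gamma>)"
proof -
  have "((mat 1 \<otimes>\<^sub>m (t *\<^sub>R M)) *v \<Gamma>) $ (i, j) = (t *\<^sub>R ((mat 1 \<otimes>\<^sub>m M) *v \<Gamma>)) $ (i, j)" for i j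
    unfolding vector_scaleR_component op_tensor_right_component by (simp add: scaleR_sum_right)
  then show ?thesis by (simp add: vec_eq_iff)
qed

lemma admissible_scaleR:
  assumes "admissible \<Gamma> c M"
  shows "admissible \<Gamma> c (t *\<^sub>R M)"
proof -
  obtain \<Psi> \<kappa> where *: "norm \<kappa> = 1" "(mat 1 \<otimes>\<^sub>m M) *v \<Gamma> = \<Psi> \<otimes> \<kappa>" "overlap_bound \<Psi> (c * (norm \<Psi>)\<^sup>2)"
    using assms by (auto simp: admissible_def)
  have "overlap_bound (t *\<^sub>R \<Psi>) (c * (norm (t *\<^sub>R \<Psi>))\<^sup>2)"
    using overlap_bound_scaleR[OF *(3), of t] by (simp add: power_mult_distrib mult_ac)
  with * show ?thesis
    unfolding admissible_def op_tensor_scaleR_right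
    by (intro exI[of _ "t *\<^sub>R \<Psi>"] exI[of _ \<kappa>]) (simp add: tensor_scaleR_left)
qed

lemma tendsto_op_tensor_right:
  assumes "(M \<longlongrightarrow> L) F"
  shows "((\<lambda>j. (mat 1 \<otimes>\<^sub>m M j) *v \<Gamma>) \<longlongrightarrow> (mat 1 \<otimes>\<^sub>m L) *v \<Gamma>) F"
proof (rule vec_tendstoI)
  have "((\<lambda>j. ((mat 1 \<otimes>\<^sub>m M j) *v \<Gamma>) $ (x, i)) \<longlongrightarrow> ((mat 1 \<otimes>\<^sub>m L) *v \<Gamma>) $ (x, i)) F" for x i
    unfolding op_tensor_right_component by (intro tendsto_intros assms)
  then show "((\<lambda>j. ((mat 1 \<otimes>\<^sub>m M j) *v \<Gamma>) $ p) \<longlongrightarrow> ((mat 1 \<otimes>\<^sub>m L) *v \<Gamma>) $ p) F" for p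
    by (cases p) blast
qed

lemma tendsto_contr_right:
  assumes "(v \<longlongrightarrow> w) F" "(\<Phi> \<longlongrightarrow> \<Phi>') F"
  shows "((\<lambda>j. contr_right (v j) (\<Phi> j)) \<longlongrightarrow> contr_right w \<Phi>') F"
  unfolding contr_right_def by (intro tendsto_intros assms)

lemma tendsto_tensor:
  assumes "(u \<longlongrightarrow> u') F" "(v \<longlongrightarrow> v') F"
  shows "((\<lambda>j. u j \<otimes> v j) \<longlongrightarrow> u' \<otimes> v') F"
  unfolding ket_tensor_def by (intro tendsto_intros assms)

lemma tendsto_cinner:
  assumes "(v \<longlongrightarrow> w) F"
  shows "((\<lambda>j. cinner u (v j)) \<longlongrightarrow> cinner u w) F"
  unfolding cinner_def by (intro tendsto_intros assms)

lemma tendsto_adj_mult: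
  assumes "(M \<longlongrightarrow> L) F"
  shows "((\<lambda>j. adj (M j) ** M j) \<longlongrightarrow> adj L ** L) F"
  unfolding adj_def matrix_matrix_mult_def vec_lambda_beta by (intro tendsto_intros assms)

text \<open>
  The factor \<open>\<Psi>\<close> is recovered from \<open>\<kappa>\<close> by contraction, so it converges along with the operator
  and \<open>\<kappa>\<close>.
\<close>

lemma admissible_limit:
  fixes M :: "nat \<Rightarrow> complex ^ 'k ^ 'k" and \<Gamma> :: "complex ^ (('m::finite \<times> 'n::finite) \<times> 'k::finite)"
  assumes M: "\<And>j. norm (M j) = 1" "\<And>j. admissible \<Gamma> (c j) (M j)" and c: "c \<longlonglongrightarrow> c0"
  obtains L h where "strict_mono h" "(M \<circ> h) \<longlonglongrightarrow> L" "norm L = 1" "admissible \<Gamma> c0 L"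
proof -
  have "\<forall>j. \<exists>\<Psi> \<kappa>. norm \<kappa> = 1 \<and> (mat 1 \<otimes>\<^sub>m M j) *v \<Gamma> = \<Psi> \<otimes> \<kappa> \<and> overlap_bound \<Psi> (c j * (norm \<Psi>)\<^sup>2)"
    using M(2) by (simp add: admissible_def)
  then obtain \<Psi> \<kappa> where \<kappa>: "\<And>j. norm (\<kappa> j) = 1" and eq: "\<And>j. (mat 1 \<otimes>\<^sub>m M j) *v \<Gamma> = \<Psi> j \<otimes> \<kappa> j"
    and bd: "\<And>j. overlap_bound (\<Psi> j) (c j * (norm (\<Psi> j))\<^sup>2)"
    by metis
  have \<Psi>: "\<Psi> j = contr_right (\<kappa> j) ((mat 1 \<otimes>\<^sub>m M j) *v \<Gamma>)" for j
    by (simp add: eq contr_right_tensor cinner_self \<kappa>)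
  \<comment> \<open>Compactness is applied to pairs, so that the operator and its ket \<kappa>
    converge along the same subsequence.\<close>
  let ?S = "sphere 0 1 \<times> sphere 0 1 :: ((complex ^ 'k ^ 'k) \<times> (complex ^ 'k)) set"
  have "compact ?S" by (intro compact_Times compact_sphere)
  moreover have "(M j, \<kappa> j) \<in> ?S" for j using M \<kappa> by simp
  ultimately have "\<exists>l\<in>?S. \<exists>h. strict_mono h \<and> ((\<lambda>j. (M j, \<kappa> j)) \<circ> h) \<longlonglongrightarrow> l"
    unfolding compact_def by simp
  then obtain l h where l: "l \<in> ?S" and h: "strict_mono h"
    and lim: "((\<lambda>j. (M j, \<kappa> j)) \<circ> h) \<longlonglongrightarrow> l"
    by blast
  obtain L k where lk: "l = (L, k)" by fastforce
  have limM: "(\<lambda>j. M (h j)) \<longlonglongrightarrow> L" and limk: "(\<lambda>j. \<kappa> (h j)) \<longlonglongrightarrow> k"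
    using tendsto_fst[OF lim] tendsto_snd[OF lim] by (simp_all add: lk o_def)
  have limc: "(\<lambda>j. c (h j)) \<longlonglongrightarrow> c0"
    using LIMSEQ_subseq_LIMSEQ[OF c h] by (simp add: o_def)
  define \<Psi>' where "\<Psi>' = contr_right k ((mat 1 \<otimes>\<^sub>m L) *v \<Gamma>)"
  have lim\<Psi>: "(\<lambda>j. \<Psi> (h j)) \<longlonglongrightarrow> \<Psi>'"
    unfolding \<Psi> \<Psi>'_def by (intro tendsto_contr_right tendsto_op_tensor_right limM limk)
  have "(\<lambda>j. (mat 1 \<otimes>\<^sub>m M (h j)) *v \<Gamma>) \<longlonglongrightarrow> \<Psi>' \<otimes> k"
    unfolding eq by (intro tendsto_tensor lim\<Psi> limk)
  then have "(mat 1 \<otimes>\<^sub>m L) *v \<Gamma> = \<Psi>' \<otimes> k"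
    using tendsto_op_tensor_right[OF limM] LIMSEQ_unique by blast
  moreover have "overlap_bound \<Psi>' (c0 * (norm \<Psi>')\<^sup>2)"
    unfolding overlap_bound_def
  proof (intro allI)
    fix u v
    have "(\<lambda>j. (norm (cinner (u \<otimes> v) (\<Psi> (h j))))\<^sup>2) \<longlonglongrightarrow> (norm (cinner (u \<otimes> v) \<Psi>'))\<^sup>2"
      by (intro tendsto_intros tendsto_cinner lim\<Psi>)
    moreover have "(\<lambda>j. c (h j) * (norm (\<Psi> (h j)))\<^sup>2 * (norm u)\<^sup>2 * (norm v)\<^sup>2)
        \<longlonglongrightarrow> c0 * (norm \<Psi>')\<^sup>2 * (norm u)\<^sup>2 * (norm v)\<^sup>2"
      by (intro tendsto_intros limc lim\<Psi>)
    moreover have "(norm (cinner (u \<otimes> v) (\<Psi> (h j))))\<^sup>2 \<le> c (h j) * (norm (\<Psi> (h j)))\<^sup>2 * (norm u)\<^sup>2 * (norm v)\<^sup>2" for j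
      using bd[of "h j"] by (simp add: overlap_bound_def)
    ultimately show "(norm (cinner (u \<otimes> v) \<Psi>'))\<^sup>2 \<le> c0 * (norm \<Psi>')\<^sup>2 * (norm u)\<^sup>2 * (norm v)\<^sup>2"
      by (intro LIMSEQ_le) auto
  qed
  ultimately have "admissible \<Gamma> c0 L"
    using l by (auto simp: admissible_def lk)
  with h limM l show thesis by (intro that[of h L]) (simp_all add: o_def lk)
qed

text \<open>The squared norm of \<open>M m\<close> is the trace of its effect, and the identity has
  trace equal to the dimension. This fixes the weights with which the normalised effects average to
  the normalised identity.\<close>

lemma povm_sum_norm:
  fixes M :: "nat \<Rightarrow> complex ^ 'k ^ 'k::finite"
  assumes "povm n M"
  shows "(\<Sum>m<n. (norm (M m))\<^sup>2) = CARD('k)"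
proof -
  have "complex_of_real ((norm (M m))\<^sup>2) = (\<Sum>l\<in>UNIV. (adj (M m) ** M m) $ l $ l)" for m
  proof -
    have "complex_of_real ((norm (M m))\<^sup>2) = (\<Sum>i\<in>UNIV. \<Sum>l\<in>UNIV. of_real ((cmod (M m $ i $ l))\<^sup>2))"
      by (simp add: norm_sq_vec)
    also have "\<dots> = (\<Sum>l\<in>UNIV. \<Sum>i\<in>UNIV. of_real ((cmod (M m $ i $ l))\<^sup>2))"
      by (rule sum.swap)
    also have "\<dots> = (\<Sum>l\<in>UNIV. (adj (M m) ** M m) $ l $ l)"
      by (simp add: adj_def matrix_matrix_mult_def mult_cnj_self mult.commute[of "cnj _"])
    finally show ?thesis .
  qed
  then have "complex_of_real (\<Sum>m<n. (norm (M m))\<^sup>2) = (\<Sum>m<n. \<Sum>l\<in>UNIV. (adj (M m) ** M m) $ l $ l)"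
    by (simp only: of_real_sum)
  also have "\<dots> = (\<Sum>l\<in>UNIV. (\<Sum>m<n. adj (M m) ** M m) $ l $ l)"
    by (subst sum.swap) simp
  also have "\<dots> = of_real (CARD('k))"
    using assms by (simp add: povm_def mat_def)
  finally show ?thesis by (simp only: of_real_eq_iff)
qed

lemma adj_mult_scaleR: "adj (t *\<^sub>R M) ** (t *\<^sub>R M) = t\<^sup>2 *\<^sub>R (adj M ** M)" for M :: "complex ^ 'k ^ 'k"
  by (simp add: adj_def matrix_matrix_mult_def vec_eq_iff scaleR_sum_right power2_eq_square)

text \<open>
  A POVM with operators in a cone exists iff the normalised identity lies in the convex hull of a
  compact base of that cone. Were it outside for \<open>c0\<close>, a strictly separating functional would
  select from the POVM at each \<open>c > c0\<close> a unit operator on its side, and these have a limit point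
  that is admissible for \<open>c0\<close>.
\<close>

lemma povm_admissible_attained:
  fixes \<Gamma> :: "complex ^ (('m::finite \<times> 'n::finite) \<times> 'k::finite)"
  assumes approx: "\<And>c. c > c0 \<Longrightarrow> \<exists>n M. povm n M \<and> (\<forall>m<n. admissible \<Gamma> c (M m))"
  obtains n M where "povm n M" "\<forall>m<n. admissible \<Gamma> c0 (M m)"
proof -
  define d where "d = real CARD('k)"
  have d: "d > 0" by (simp add: d_def)
  \<comment> \<open>Effects of unit operators have trace one, which cuts a bounded slice out of the
    cone. Dividing the identity by its trace \<open>d\<close> puts it into the same slice.\<close>
  define T where "T = (\<lambda>M. adj M ** M) ` {M. norm M = 1 \<and> admissible \<Gamma> c0 M}"
  have "compact T"
    unfolding compact_def
  proof (intro allI impI)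
    fix X :: "nat \<Rightarrow> complex ^ 'k ^ 'k" assume "\<forall>j. X j \<in> T"
    then have "\<forall>j. \<exists>M. norm M = 1 \<and> admissible \<Gamma> c0 M \<and> X j = adj M ** M"
      by (auto simp: T_def)
    then obtain M where M: "\<And>j. norm (M j) = 1" "\<And>j. admissible \<Gamma> c0 (M j)" "\<And>j. X j = adj (M j) ** M j"
      by metis
    obtain L h where "strict_mono h" "(M \<circ> h) \<longlonglongrightarrow> L" "norm L = 1" "admissible \<Gamma> c0 L"
      by (rule admissible_limit[OF M(1,2) tendsto_const])
    moreover from this(2) have "(X \<circ> h) \<longlonglongrightarrow> adj L ** L"
      using tendsto_adj_mult[of "M \<circ> h"] by (simp add: o_def M)
    ultimately show "\<exists>l\<in>T. \<exists>r. strict_mono r \<and> (X \<circ> r) \<longlonglongrightarrow> l"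
      by (auto simp: T_def)
  qed
  have "(1 / d) *\<^sub>R mat 1 \<in> convex hull T"
  proof (rule ccontr)
    assume "(1 / d) *\<^sub>R mat 1 \<notin> convex hull T"
    moreover have "closed (convex hull T)"
      using \<open>compact T\<close> by (intro compact_imp_closed compact_convex_hull)
    ultimately obtain a b where ab: "a \<bullet> ((1 / d) *\<^sub>R mat 1) < b" "\<And>x. x \<in> convex hull T \<Longrightarrow> b < a \<bullet> x"
      using separating_hyperplane_closed_point[OF convex_convex_hull] by metis
    have pick: "\<exists>M. norm M = 1 \<and> admissible \<Gamma> c M \<and> a \<bullet> (adj M ** M) \<le> b" if c: "c > c0" for c
    proof -
      obtain n M where M: "povm n M" "\<forall>m<n. admissible \<Gamma> c (M m)" using approx[OF c] by blast
      \<comment> \<open>With weights \<open>(norm (M m))\<^sup>2 / d\<close> the normalised effects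
        average to the normalised identity, where the functional is below \<open>b\<close>; hence it
        is below \<open>b\<close> at one of them.\<close>
      have "\<exists>m<n. a \<bullet> (adj (M m) ** M m) < b * (norm (M m))\<^sup>2"
      proof (rule ccontr)
        assume "\<not> ?thesis"
        then have "(\<Sum>m<n. b * (norm (M m))\<^sup>2) \<le> (\<Sum>m<n. a \<bullet> (adj (M m) ** M m))"
          by (intro sum_mono) (metis lessThan_iff not_less)
        also have "\<dots> = a \<bullet> mat 1"
          using M(1) by (simp add: povm_def flip: inner_sum_right)
        also have "\<dots> = d * (a \<bullet> ((1 / d) *\<^sub>R mat 1))"
          using d by simp
        also have "\<dots> < d * b" using ab(1) d by (rule mult_strict_left_mono)
        also have "\<dots> = (\<Sum>m<n. b * (norm (M m))\<^sup>2)"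
          by (simp add: d_def povm_sum_norm[OF M(1)] flip: sum_distrib_left)
        finally show False by simp
      qed
      then obtain m where m: "m < n" "a \<bullet> (adj (M m) ** M m) < b * (norm (M m))\<^sup>2" by blast
      \<comment> \<open>For the zero operator the strict inequality would read 0 < 0, so the chosen
        one can be normalised.\<close>
      then have "M m \<noteq> 0" by (auto simp: adj_zero)
      then have "a \<bullet> (adj ((1 / norm (M m)) *\<^sub>R M m) ** ((1 / norm (M m)) *\<^sub>R M m)) < b"
        using m(2) by (simp only: adj_mult_scaleR inner_scaleR_right) (simp add: power_divide field_simps)
      with \<open>M m \<noteq> 0\<close> M(2) m(1) show ?thesis
        by (intro exI[of _ "(1 / norm (M m)) *\<^sub>R M m"]) (auto intro: admissible_scaleR)
    qed
    have "\<forall>j::nat. \<exists>M. norm M = 1 \<and> admissible \<Gamma> (c0 + inverse (real (Suc j))) M \<and> a \<bullet> (adj M ** M) \<le> b"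
      using pick by simp
    then obtain M where M: "\<And>j. norm (M j) = 1" "\<And>j::nat. admissible \<Gamma> (c0 + inverse (real (Suc j))) (M j)"
        "\<And>j. a \<bullet> (adj (M j) ** M j) \<le> b"
      by metis
    obtain L h where L: "strict_mono h" "(M \<circ> h) \<longlonglongrightarrow> L" "norm L = 1" "admissible \<Gamma> c0 L"
      using admissible_limit[OF M(1,2) LIMSEQ_inverse_real_of_nat_add] by metis
    have "(\<lambda>j. a \<bullet> (adj ((M \<circ> h) j) ** (M \<circ> h) j)) \<longlonglongrightarrow> a \<bullet> (adj L ** L)"
      by (intro tendsto_intros tendsto_adj_mult L)
    \<comment> \<open>Only the weak inequality survives the limit, but the separation is strict on
      the hull.\<close>
    then have "a \<bullet> (adj L ** L) \<le> b"
      by (rule LIMSEQ_le_const2) (simp add: M)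
    moreover have "adj L ** L \<in> convex hull T"
      using L by (intro hull_inc) (auto simp: T_def)
    ultimately show False using ab(2) by fastforce
  qed
  then obtain n u x where u: "\<forall>i\<in>{1..n::nat}. 0 \<le> u i \<and> x i \<in> T"
    and x: "(\<Sum>i=1..n. u i *\<^sub>R x i) = (1 / d) *\<^sub>R mat 1"
    unfolding convex_hull_indexed by blast
  \<comment> \<open>The hull combination is numbered from 1 and a POVM from 0, hence
    \<open>Suc i\<close>.\<close>
  have "\<forall>i. \<exists>M. i < n \<longrightarrow> admissible \<Gamma> c0 M \<and> x (Suc i) = adj M ** M"
    using u by (fastforce simp: T_def)
  then obtain M where M: "\<And>i. i < n \<Longrightarrow> admissible \<Gamma> c0 (M i)" "\<And>i. i < n \<Longrightarrow> x (Suc i) = adj (M i) ** M i"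
    by metis
  \<comment> \<open>Effects are quadratic in the operator, so the hull weight enters through its
    square root; \<open>d\<close> restores the identity from its normalised form.\<close>
  define M' where "M' i = sqrt (d * u (Suc i)) *\<^sub>R M i" for i
  have "(\<Sum>i<n. adj (M' i) ** M' i) = (\<Sum>i<n. d *\<^sub>R (u (Suc i) *\<^sub>R x (Suc i)))"
  proof (intro sum.cong refl)
    fix i assume "i \<in> {..<n}"
    then have "i < n" "0 \<le> u (Suc i)" using u by auto
    then show "adj (M' i) ** M' i = d *\<^sub>R (u (Suc i) *\<^sub>R x (Suc i))"
      using d by (simp add: M'_def adj_mult_scaleR M)
  qed
  also have "\<dots> = d *\<^sub>R (\<Sum>i=1..n. u i *\<^sub>R x i)"
    by (simp add: sum.atLeast1_atMost_eq scaleR_sum_right)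
  also have "\<dots> = mat 1"
    unfolding x using d by simp
  finally have "povm n M'" by (simp add: povm_def)
  moreover have "\<forall>m<n. admissible \<Gamma> c0 (M' m)"
    using M(1) by (simp add: M'_def admissible_scaleR)
  ultimately show thesis by (rule that)
qed

subsection \<open>Bank measurements\<close>

lemma initial_state_nonzero:
  assumes "0 < \<theta>" "\<theta> < pi / 2" "\<Omega> \<noteq> 0"
  shows "initial_state \<theta> \<Omega> \<noteq> 0"
proof
  assume "initial_state \<theta> \<Omega> = 0"
  then have "initial_state \<theta> \<Omega> $ (((0, a), (0, b)), k) = 0" for a b k by simp
  then have "psi \<theta> $ (0, 0) * \<Omega> $ (a, b, k) = 0" for a b k
    by (simp add: initial_state_def)
  moreover have "psi \<theta> $ (0, 0) = of_real (cos \<theta>)"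
    by (simp add: psi_def ket_tensor_def ket_def axis_def scaleR_conv_of_real[where 'a = complex])
  moreover have "cos \<theta> > 0" using assms by (intro cos_gt_zero) auto
  ultimately have "\<Omega> $ (a, b, k) = 0" for a b k by simp
  then show False using assms(3) by (auto simp: vec_eq_iff)
qed

text \<open>If every branch vanished, completeness would make every partial inner product of the
  initial state vanish. The lemma keeps the set under \<open>Sup\<close> in \<open>mu_star\<close>
  nonempty.\<close>

lemma bank_measurement_some_outcome:
  assumes bm: "bank_measurement \<theta> \<Omega> n M \<Psi>" and nz: "initial_state \<theta> \<Omega> \<noteq> 0"
  obtains m where "m < n" "outcome_prob (\<Psi> m) > 0"
proof (rule ccontr)
  assume "\<not> thesis"
  then have "\<forall>m<n. \<not> outcome_prob (\<Psi> m) > 0" using that by blast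
  then have \<Psi>: "\<Psi> m = 0" if "m < n" for m
    using that by (simp add: outcome_prob_eq)
  let ?\<Gamma> = "initial_state \<theta> \<Omega>"
  have M0: "(mat 1 \<otimes>\<^sub>m M m) *v ?\<Gamma> = 0" if "m < n" for m
    using bm that \<Psi>[OF that] by (auto simp: bank_measurement_def)
  have "contr_left u ?\<Gamma> = 0" for u
  proof -
    have "(norm (contr_left u ?\<Gamma>))\<^sup>2 = (\<Sum>m<n. (norm (M m *v contr_left u ?\<Gamma>))\<^sup>2)"
      using bm by (intro sum_norm_kraus[symmetric]) (simp add: bank_measurement_def povm_def)
    also have "\<dots> = 0"
      by (intro sum.neutral) (simp add: M0 contr_left_0 flip: contr_left_op_right)
    finally show ?thesis by simp
  qed
  then have "overlap_bound ?\<Gamma> 0"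
    by (simp add: overlap_bound_def cinner_tensor_left)
  with nz show False by (simp add: overlap_bound_0_iff)
qed

text \<open>Measuring \<open>K\<close> in the computational basis leaves it in a known ket, so every
  branch is a product. This makes the set under \<open>Inf\<close> nonempty.\<close>

lemma bank_measurement_exists:
  fixes \<Omega> :: "complex ^ ('a::finite \<times> 'b::finite \<times> 'k::finite)"
  obtains n M \<Psi> where "bank_measurement \<theta> \<Omega> n M \<Psi>"
proof -
  obtain h where "bij_betw h {0..<CARD('k)} (UNIV :: 'k set)"
    using ex_bij_betw_nat_finite[of "UNIV :: 'k set"] by auto
  then have h: "bij_betw h {..<CARD('k)} (UNIV :: 'k set)" by (simp add: atLeast0LessThan)
  define M where "M m = outer (ket (h m)) (ket (h m))" for m
  have "(\<Sum>m<CARD('k). adj (M m) ** M m) = mat 1"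
    unfolding kraus_complete_iff
  proof
    fix x :: "complex ^ 'k"
    have "(\<Sum>m<CARD('k). adj (M m) *v (M m *v x)) = (\<Sum>m<CARD('k). x $ h m *s ket (h m))"
      by (simp add: M_def adj_outer outer_mult cinner_scale_right cinner_ket) (simp add: ket_def axis_def)
    also have "\<dots> = (\<Sum>k\<in>UNIV. x $ k *s ket k)"
      by (rule sum.reindex_bij_betw[OF h])
    also have "\<dots> = x"
      unfolding ket_def by (rule basis_expansion)
    finally show "(\<Sum>m<CARD('k). adj (M m) *v (M m *v x)) = x" .
  qed
  moreover have "(mat 1 \<otimes>\<^sub>m M m) *v \<Gamma> = contr_right (ket (h m)) \<Gamma> \<otimes> ket (h m)" for m and \<Gamma> :: "complex ^ (((2 \<times> 'a) \<times> (2 \<times> 'b)) \<times> 'k)"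
  proof -
    have "((mat 1 \<otimes>\<^sub>m M m) *v \<Gamma>) $ (x, i) = (contr_right (ket (h m)) \<Gamma> \<otimes> ket (h m)) $ (x, i)" for x i
      unfolding op_tensor_right_component
      by (simp add: M_def outer_def contr_right_def ket_tensor_def sum_distrib_left mult_ac)
    then show ?thesis by (simp add: vec_eq_iff)
  qed
  ultimately have "bank_measurement \<theta> \<Omega> (CARD('k)) M (\<lambda>m. contr_right (ket (h m)) (initial_state \<theta> \<Omega>))"
    unfolding bank_measurement_def povm_def using norm_ket by blast
  then show thesis by (rule that)
qed

lemma norm_normalized: "outcome_prob \<Psi> > 0 \<Longrightarrow> norm (normalized \<Psi>) = 1"
  by (simp add: normalized_def outcome_prob_eq)

lemma overlap_bound_normalized_iff:
  assumes "outcome_prob \<Psi> > 0"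
  shows "overlap_bound (normalized \<Psi>) c \<longleftrightarrow> overlap_bound \<Psi> (c * (norm \<Psi>)\<^sup>2)"
proof
  have n: "norm \<Psi> > 0" using assms by (simp add: outcome_prob_eq)
  have \<Psi>: "normalized \<Psi> = (1 / norm \<Psi>) *\<^sub>R \<Psi>" by (simp add: normalized_def outcome_prob_eq)
  show "overlap_bound \<Psi> (c * (norm \<Psi>)\<^sup>2)" if "overlap_bound (normalized \<Psi>) c"
    using overlap_bound_scaleR[OF that, of "norm \<Psi>"] n by (simp add: \<Psi> mult.commute)
  show "overlap_bound (normalized \<Psi>) c" if "overlap_bound \<Psi> (c * (norm \<Psi>)\<^sup>2)"
    using overlap_bound_scaleR[OF that, of "1 / norm \<Psi>"] n by (simp add: \<Psi> power_divide)
qed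

abbreviation outcome_lambdas :: "nat \<Rightarrow> (nat \<Rightarrow> complex ^ ('m::finite \<times> 'n::finite)) \<Rightarrow> real set" where
  "outcome_lambdas n \<Psi> \<equiv> {lambda_max (normalized (\<Psi> m)) | m. m < n \<and> outcome_prob (\<Psi> m) > 0}"

lemma finite_outcome_lambdas: "finite (outcome_lambdas n \<Psi>)"
  by simp

text \<open>Unit ancillas leave the Schmidt coefficients unchanged, so Nielsen's protocol can be run
  on the extended state for any prescribed ancillas.\<close>

lemma restores_bell:
  fixes \<alpha> :: "complex ^ 'x::finite" and \<beta> :: "complex ^ 'y::finite"
  assumes n: "norm \<Psi> = 1" and bd: "overlap_bound \<Psi> (1 / 2)" and \<alpha>: "norm \<alpha> = 1" and \<beta>: "norm \<beta> = 1"
  obtains \<Lambda> where "locc \<Lambda>" "reduced_AB (\<Lambda> (proj (with_ancillas \<alpha> \<beta> \<Psi>))) = proj bell"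
proof -
  have "\<Psi> \<noteq> 0" using n by auto
  then obtain r s e f where sd: "schmidt_decomposition \<Psi> r s e f"
    by (rule schmidt_exists_max)
  note sd' = schmidt_decomposition_with_ancillas[OF \<alpha> \<beta> sd]
  have "(s i)\<^sup>2 \<le> 1 / 2" if "i < r" for i
    using schmidt_coeff_sq_le[OF bd] sd that unfolding schmidt_coeffs_def by blast
  moreover have "norm (with_ancillas \<alpha> \<beta> \<Psi>) = 1"
    using norm_sq_schmidt[OF sd] norm_sq_schmidt[OF sd'] n by (simp add: power2_eq_1_iff) (smt (verit) norm_ge_zero)
  ultimately show thesis using locc_restores_bell[OF sd'] that by blast
qed

text \<open>Besides the comparison itself, the real \<open>Sup\<close> needs a positive-probability
  outcome, and the real \<open>Inf\<close> a lower bound, which is 0 since each supremum dominates a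
  nonnegative \<open>lambda_max\<close>.\<close>

lemma mu_star_le:
  assumes bm: "bank_measurement \<theta> \<Omega> n M \<Psi>" and nz: "initial_state \<theta> \<Omega> \<noteq> 0"
    and le: "\<And>m. m < n \<Longrightarrow> outcome_prob (\<Psi> m) > 0 \<Longrightarrow> lambda_max (normalized (\<Psi> m)) \<le> c"
  shows "mu_star \<theta> \<Omega> \<le> c"
proof -
  have "Sup (outcome_lambdas n \<Psi>) \<le> c"
  proof (rule cSup_least)
    show "outcome_lambdas n \<Psi> \<noteq> {}"
      using bank_measurement_some_outcome[OF bm nz] by blast
  qed (use le in blast)
  moreover have "mu_star \<theta> \<Omega> \<le> Sup (outcome_lambdas n \<Psi>)"
    unfolding mu_star_def
  proof (rule cInf_lower)
    show "Sup (outcome_lambdas n \<Psi>)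
        \<in> {Sup (outcome_lambdas n \<Psi>) | n M \<Psi>. bank_measurement \<theta> \<Omega> n M \<Psi>}"
      by (rule CollectI, rule exI[of _ n], rule exI[of _ M], rule exI[of _ \<Psi>], rule conjI, rule refl, rule bm)
    show "bdd_below {Sup (outcome_lambdas n \<Psi>) | n M \<Psi>. bank_measurement \<theta> \<Omega> n M \<Psi>}"
    proof (rule bdd_belowI)
      fix x assume "x \<in> {Sup (outcome_lambdas n \<Psi>) | n M \<Psi>. bank_measurement \<theta> \<Omega> n M \<Psi>}"
      then obtain n M \<Psi> where x: "x = Sup (outcome_lambdas n \<Psi>)" and bm: "bank_measurement \<theta> \<Omega> n M \<Psi>"
        by blast
      obtain m where m: "m < n" "outcome_prob (\<Psi> m) > 0"
        using bank_measurement_some_outcome[OF bm nz] .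
      have "normalized (\<Psi> m) \<noteq> 0" using norm_normalized[OF m(2)] by auto
      then have "0 \<le> lambda_max (normalized (\<Psi> m))"
        by (rule lambda_max_nonneg)
      also have "\<dots> \<le> x"
        unfolding x using m by (intro cSup_upper bdd_above_finite finite_outcome_lambdas) blast
      finally show "0 \<le> x" .
    qed
  qed
  ultimately show ?thesis by simp
qed

lemma mu_star_lessE:
  assumes "mu_star \<theta> \<Omega> < c"
  obtains n M \<Psi> where "bank_measurement \<theta> \<Omega> n M \<Psi>"
    "\<forall>m<n. outcome_prob (\<Psi> m) > 0 \<longrightarrow> lambda_max (normalized (\<Psi> m)) \<le> c"
proof -
  let ?X = "{Sup (outcome_lambdas n \<Psi>) | n M \<Psi>. bank_measurement \<theta> \<Omega> n M \<Psi>}"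
  obtain n0 M0 \<Psi>0 where "bank_measurement \<theta> \<Omega> n0 M0 \<Psi>0"
    by (rule bank_measurement_exists)
  then have "?X \<noteq> {}" by blast
  moreover have "Inf ?X < c" using assms by (simp only: mu_star_def)
  ultimately have "\<exists>x\<in>?X. x < c" by (rule cInf_lessD)
  then obtain n M \<Psi> where bm: "bank_measurement \<theta> \<Omega> n M \<Psi>" and less: "Sup (outcome_lambdas n \<Psi>) < c"
    by blast
  have "lambda_max (normalized (\<Psi> m)) \<le> c" if "m < n" "outcome_prob (\<Psi> m) > 0" for m
  proof -
    have "lambda_max (normalized (\<Psi> m)) \<le> Sup (outcome_lambdas n \<Psi>)"
      using that by (intro cSup_upper bdd_above_finite finite_outcome_lambdas) blast
    with less show ?thesis by simp
  qed
  with bm show thesis by (intro that) auto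
qed

theorem proposition9:
  fixes \<theta> :: real
    and \<Omega> :: "complex ^ ('a::finite \<times> 'b::finite \<times> 'k::finite)"
  assumes "0 < \<theta>" and "\<theta> < pi / 2"
    and "norm \<Omega> = 1"
  shows "bell_restorable TYPE('x::finite) TYPE('y::finite) \<theta> \<Omega> \<longleftrightarrow> mu_star \<theta> \<Omega> \<le> 1 / 2"
proof -
  have nz: "initial_state \<theta> \<Omega> \<noteq> 0"
    using assms by (intro initial_state_nonzero) auto
  have norm0: "normalized \<Psi> \<noteq> 0" if "outcome_prob \<Psi> > 0" for \<Psi> :: "complex ^ ((2 \<times> 'a) \<times> (2 \<times> 'b))"
    using norm_normalized[OF that] by auto
  show ?thesis
  proof
    assume "bell_restorable TYPE('x) TYPE('y) \<theta> \<Omega>"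
    then obtain n M \<Psi> where bm: "bank_measurement \<theta> \<Omega> n M \<Psi>"
      and restore: "\<forall>m<n. outcome_prob (\<Psi> m) > 0 \<longrightarrow>
           (\<exists>(\<alpha> :: complex ^ 'x) (\<beta> :: complex ^ 'y) \<Lambda>.
              norm \<alpha> = 1 \<and> norm \<beta> = 1 \<and> locc \<Lambda> \<and>
              reduced_AB (\<Lambda> (proj (with_ancillas \<alpha> \<beta> (normalized (\<Psi> m))))) = proj bell)"
      unfolding bell_restorable_def by blast
    have "lambda_max (normalized (\<Psi> m)) \<le> 1 / 2" if m: "m < n" "outcome_prob (\<Psi> m) > 0" for m
    proof -
      obtain \<alpha> :: "complex ^ 'x" and \<beta> :: "complex ^ 'y" and \<Lambda>
        where "norm \<alpha> = 1" "norm \<beta> = 1" "locc \<Lambda>"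
          "reduced_AB (\<Lambda> (proj (with_ancillas \<alpha> \<beta> (normalized (\<Psi> m))))) = proj bell"
        using restore m by blast
      then have "overlap_bound (normalized (\<Psi> m)) (1 / 2)"
        by (blast intro: overlap_bound_with_ancillas locc_bell_overlap_bound)
      then show ?thesis by (simp only: lambda_max_le_iff[OF norm0[OF m(2)]])
    qed
    then show "mu_star \<theta> \<Omega> \<le> 1 / 2"
      by (rule mu_star_le[OF bm nz])
  next
    assume mu: "mu_star \<theta> \<Omega> \<le> 1 / 2"
    \<comment> \<open>The hypothesis on the infimum yields measurements only for each
      \<open>c\<close> above 1/2; \<open>povm_admissible_attained\<close> then passes to 1/2
      itself.\<close>
    have "\<exists>n M. povm n M \<and> (\<forall>m<n. admissible (initial_state \<theta> \<Omega>) c (M m))" if c: "c > 1 / 2" for c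
    proof -
      have "mu_star \<theta> \<Omega> < c" using mu c by simp
      then obtain n M \<Psi> where bm: "bank_measurement \<theta> \<Omega> n M \<Psi>"
        and le: "\<forall>m<n. outcome_prob (\<Psi> m) > 0 \<longrightarrow> lambda_max (normalized (\<Psi> m)) \<le> c"
        by (rule mu_star_lessE)
      have "admissible (initial_state \<theta> \<Omega>) c (M m)" if m: "m < n" for m
      proof -
        have "overlap_bound (\<Psi> m) (c * (norm (\<Psi> m))\<^sup>2)"
        proof (cases "outcome_prob (\<Psi> m) > 0")
          case True
          have "lambda_max (normalized (\<Psi> m)) \<le> c" using m True le by blast
          then show ?thesis
            by (simp add: lambda_max_le_iff[OF norm0[OF True]] overlap_bound_normalized_iff[OF True])
        next
          \<comment> \<open>A branch of probability zero is the zero ket, all of whose overlaps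
            vanish.\<close>
          case False
          then show ?thesis by (simp add: outcome_prob_eq overlap_bound_0_iff)
        qed
        then show ?thesis
          using bm m unfolding bank_measurement_def admissible_def by blast
      qed
      then show ?thesis using bm unfolding bank_measurement_def by blast
    qed
    then obtain n M where povm: "povm n M" and adm: "\<forall>m<n. admissible (initial_state \<theta> \<Omega>) (1 / 2) (M m)"
      by (rule povm_admissible_attained)
    have "\<forall>m. \<exists>\<Psi>. m < n \<longrightarrow> (\<exists>\<kappa>. norm \<kappa> = 1 \<and>
        (mat 1 \<otimes>\<^sub>m M m) *v initial_state \<theta> \<Omega> = \<Psi> \<otimes> \<kappa>) \<and> overlap_bound \<Psi> (1 / 2 * (norm \<Psi>)\<^sup>2)"
      using adm unfolding admissible_def by blast
    from choice[OF this] obtain \<Psi> where \<Psi>: "\<forall>m. m < n \<longrightarrow> (\<exists>\<kappa>. norm \<kappa> = 1 \<and>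
        (mat 1 \<otimes>\<^sub>m M m) *v initial_state \<theta> \<Omega> = \<Psi> m \<otimes> \<kappa>) \<and>
        overlap_bound (\<Psi> m) (1 / 2 * (norm (\<Psi> m))\<^sup>2)" ..
    have "bank_measurement \<theta> \<Omega> n M \<Psi>"
      unfolding bank_measurement_def using povm \<Psi> by blast
    moreover have "\<exists>(\<alpha> :: complex ^ 'x) (\<beta> :: complex ^ 'y) \<Lambda>. norm \<alpha> = 1 \<and> norm \<beta> = 1 \<and> locc \<Lambda> \<and>
        reduced_AB (\<Lambda> (proj (with_ancillas \<alpha> \<beta> (normalized (\<Psi> m))))) = proj bell"
      if m: "m < n" "outcome_prob (\<Psi> m) > 0" for m
    proof -
      \<comment> \<open>Any unit ancillas would do; a basis ket at an arbitrary index exists in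
        every dimension.\<close>
      let ?\<alpha> = "ket undefined :: complex ^ 'x" and ?\<beta> = "ket undefined :: complex ^ 'y"
      have "overlap_bound (normalized (\<Psi> m)) (1 / 2)"
        unfolding overlap_bound_normalized_iff[OF m(2)] using \<Psi> m(1) by blast
      then obtain \<Lambda> where "locc \<Lambda>"
        "reduced_AB (\<Lambda> (proj (with_ancillas ?\<alpha> ?\<beta> (normalized (\<Psi> m))))) = proj bell"
        by (rule restores_bell[OF norm_normalized[OF m(2)] _ norm_ket norm_ket])
      then show ?thesis
        by (intro exI[of _ ?\<alpha>] exI[of _ ?\<beta>] exI[of _ \<Lambda>]) simp
    qed
    ultimately show "bell_restorable TYPE('x) TYPE('y) \<theta> \<Omega>"
      unfolding bell_restorable_def
      by (intro exI[of _ n] exI[of _ M] exI[of _ \<Psi>] conjI allI impI)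
  qed
qed

end
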